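(* Let $r_1,r_2,\rho_1,\rho_2$ be real numbers with $\rho_1+\rho_2-r_1-r_2\notin\{-1,-2,\dots\}$. Put $$q=-e^{\varepsilon},\quad a=-ie^{\varepsilon(2\rho_1+1/2)},\quad b=-ie^{\varepsilon(2\rho_2+1/2)},\quad c=ie^{\varepsilon(-2r_2+1/2)},\quad d=ie^{\varepsilon(-2r_1+1/2)},\quad z=ie^{-2\varepsilon y}$$ with $y$ real. Consider the Askey-Wilson difference equation $$\Omega(z)R_n(x(zq))+\Omega(z^{-1})R_n(x(zq^{-1}))-(\Omega(z)+\Omega(z^{-1}))R_n(x(z))=\Lambda_nR_n(x(z)),$$ $$\Omega(z)=\frac{(1-az)(1-bz)(1-cz)(1-dz)}{(1-z^2)(1-qz^2)},\qquad \Lambda_n=(q^{-n}-1)(1-abcdq^{n-1}),$$ and let $R_n^{(-1)}(y)=\lim_{\varepsilon\to0}R_n(x(z))$ be the limiting (Bannai-Ito) polynomials. In the limit $\varepsilon\to0$ the operation $R_n(x(z))\to R_n(x(zq))$ becomes $R_n^{(-1)}(y)\to R_n^{(-1)}(-y+\frac12)$, the operation $R_n(x(z))\to R_n(x(zq^{-1}))$ becomes $R_n^{(-1)}(y)\to R_n^{(-1)}(-y-\frac12)$, and the difference equation, divided by $4(1+q)$, becomes $$\Phi_1(y)R_n^{(-1)}(-y+\tfrac12)+\Phi_2(y)R_n^{(-1)}(-y-\tfrac12)-(\Phi_1(y)+\Phi_2(y))R_n^{(-1)}(y)=\lambda_nR_n^{(-1)}(y),$$ where $$\Phi_1(y)=\lim_{\varepsilon\to0}\frac{\Omega(z)}{4(1+q)}=-\frac{2(y-\rho_1-\frac14)(y-\rho_2-\frac14)}{4y-1},\qquad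 \Phi_2(y)=\lim_{\varepsilon\to0}\frac{\Omega(z^{-1})}{4(1+q)}=\frac{2(y-r_1+\frac14)(y-r_2+\frac14)}{4y+1},$$ and $\lambda_n=\lim_{\varepsilon\to0}\frac{\Lambda_n}{4(1+q)}$ equals $\frac n2$ for even $n$ and $r_1+r_2-\rho_1-\rho_2-\frac{n+1}2$ for odd $n$. That is, $HR_n^{(-1)}=\lambda_nR_n^{(-1)}$ with the Dunkl shift operator $$H=\Phi_1(y)T^{-1/2}R+\Phi_2(y)T^{1/2}R-(\Phi_1(y)+\Phi_2(y)).$$ Moreover, for real $h$, $$T^hHT^{-h}=\Phi_1(y+h)T^{2h-1/2}R+\Phi_2(y+h)T^{2h+1/2}R-\Phi_1(y+h)-\Phi_2(y+h).$$ For $h=\frac14$ this is the operator $$L=F(y)(I-R)+G(y)(T^{+}R-I),\qquad F(y)=-\Phi_1(y+\tfrac14)=\frac{(y-\rho_1)(y-\rho_2)}{2y},\quad G(y)=\Phi_2(y+\tfrac14)=\frac{(y-r_1+\frac12)(y-r_2+\frac12)}{2y+1},$$ and for $h=-\frac14$ it is $\Phi_1(y-\frac14)T^{-}R+\Phi_2(y-\frac14)R-\Phi_1(y-\frac14)-\Phi_2(y-\frac14)$.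
   Context: Operators act on functions $f(y)$: $Rf(y)=f(-y)$, $T^hf(y)=f(y+h)$, $T^{\pm}=T^{\pm1}$, $I$ is the identity; thus $T^hRf(y)=f(-y-h)$. With $x(z)=(z+z^{-1})/2$, the Askey-Wilson polynomials are taken as $$R_n(x(z))={}_4\Phi_3\left({q^{-n},\,abcdq^{n-1},\,az,\,az^{-1}\atop ab,\,ac,\,ad}\,\Big|\,q;q\right)$$ (parameters being such that this terminating series is defined). The limit $R_n^{(-1)}(y)$ exists and is a polynomial of degree $n$ in $y$; its monic version is $P_n(y-\frac14)$, where $P_n$ is the monic Bannai-Ito polynomial, i.e. the monic polynomial of degree $n$ with $LP_n=\lambda_nP_n$. *)

theory Defs
  imports "HOL-Analysis.Analysis" "HOL-Computational_Algebra.Polynomial"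
begin

definition qpoch :: "complex \<Rightarrow> complex \<Rightarrow> nat \<Rightarrow> complex" where
  "qpoch a q k = (\<Prod>j<k. 1 - a * q ^ j)"

definition Phi43 ::
  "complex \<Rightarrow> complex \<Rightarrow> complex \<Rightarrow> complex \<Rightarrow> complex \<Rightarrow> complex \<Rightarrow> complex \<Rightarrow> complex \<Rightarrow> complex \<Rightarrow> complex"
where
  "Phi43 a1 a2 a3 a4 b1 b2 b3 q w =
    (\<Sum>k. qpoch a1 q k * qpoch a2 q k * qpoch a3 q k * qpoch a4 q k /
          (qpoch b1 q k * qpoch b2 q k * qpoch b3 q k * qpoch q q k) * w ^ k)"

definition xz :: "complex \<Rightarrow> complex" where
  "xz z = (z + inverse z) / 2"

text \<open>
  The Askey-Wilson polynomial \<open>R\<^sub>n\<close>, as a polynomial in \<open>x\<close>. It exists and is unique whenever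
  \<open>q \<noteq> 0\<close>, see \<open>poly_askey_wilson\<close> below. Since \<open>t / 0 = 0\<close>, it denotes the genuine
  Askey-Wilson polynomial only under the condition \<open>askey_wilson_defined\<close>.
\<close>

definition askey_wilson ::
  "nat \<Rightarrow> complex \<Rightarrow> complex \<Rightarrow> complex \<Rightarrow> complex \<Rightarrow> complex \<Rightarrow> complex poly" where
  "askey_wilson n a b c d q =
    (THE p. \<forall>z. z \<noteq> 0 \<longrightarrow> poly p (xz z) =
      Phi43 (q powi (- int n)) (a * b * c * d * q powi (int n - 1)) (a * z) (a * inverse z)
            (a * b) (a * c) (a * d) q q)"

text \<open>No zero denominators in the terms \<open>k \<le> n\<close> of the series; the later terms vanish.\<close>

definition askey_wilson_defined ::
  "nat \<Rightarrow> complex \<Rightarrow> complex \<Rightarrow> complex \<Rightarrow> complex \<Rightarrow> complex \<Rightarrow> bool" where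
  "askey_wilson_defined n a b c d q \<longleftrightarrow>
    q \<noteq> 0 \<and> (\<forall>k\<le>n. qpoch (a * b) q k \<noteq> 0 \<and> qpoch (a * c) q k \<noteq> 0 \<and>
                 qpoch (a * d) q k \<noteq> 0 \<and> qpoch q q k \<noteq> 0)"

definition aw_Omega ::
  "complex \<Rightarrow> complex \<Rightarrow> complex \<Rightarrow> complex \<Rightarrow> complex \<Rightarrow> complex \<Rightarrow> complex" where
  "aw_Omega a b c d q z =
    ((1 - a * z) * (1 - b * z) * (1 - c * z) * (1 - d * z)) / ((1 - z\<^sup>2) * (1 - q * z\<^sup>2))"

definition aw_Lambda ::
  "nat \<Rightarrow> complex \<Rightarrow> complex \<Rightarrow> complex \<Rightarrow> complex \<Rightarrow> complex \<Rightarrow> complex" where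
  "aw_Lambda n a b c d q =
    (q powi (- int n) - 1) * (1 - a * b * c * d * q powi (int n - 1))"

lemma qpoch_terminates:
  assumes "q \<noteq> 0" "n < k"
  shows "qpoch (q powi (- int n)) q k = 0"
  unfolding qpoch_def
  using assms by (intro prod_zero) (auto simp: power_int_minus intro!: bexI[of _ n])

lemma Phi43_terminates:
  assumes "q \<noteq> 0"
  shows "Phi43 (q powi (- int n)) a2 a3 a4 b1 b2 b3 q w =
    (\<Sum>k\<le>n. qpoch (q powi (- int n)) q k * qpoch a2 q k * qpoch a3 q k * qpoch a4 q k /
          (qpoch b1 q k * qpoch b2 q k * qpoch b3 q k * qpoch q q k) * w ^ k)"
  unfolding Phi43_def
  by (rule suminf_finite) (auto simp: qpoch_terminates[OF assms])

lemma infinite_range_xz: "infinite {xz z |z. z \<noteq> 0}"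
proof
  assume "finite {xz z |z. z \<noteq> 0}"
  moreover have "w \<in> {xz z |z. z \<noteq> 0}" for w
  proof -
    define z where "z = w + csqrt (w\<^sup>2 - 1)"
    have "z * (w - csqrt (w\<^sup>2 - 1)) = 1"
      unfolding z_def using power2_csqrt[of "w\<^sup>2 - 1"]
      by (simp add: algebra_simps power2_eq_square)
    then have "z \<noteq> 0" "inverse z = w - csqrt (w\<^sup>2 - 1)"
      by (auto intro: inverse_unique)
    then have "xz z = w" unfolding xz_def z_def by simp
    with \<open>z \<noteq> 0\<close> show ?thesis by blast
  qed
  ultimately have "finite (UNIV :: complex set)"
    using finite_subset[of UNIV "{xz z |z. z \<noteq> 0}"] by blast
  then show False using infinite_UNIV_char_0 by blast
qed

lemma poly_askey_wilson:
  assumes q: "q \<noteq> 0" and z: "z \<noteq> 0"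
  shows "poly (askey_wilson n a b c d q) (xz z) =
    Phi43 (q powi (- int n)) (a * b * c * d * q powi (int n - 1)) (a * z) (a * inverse z)
          (a * b) (a * c) (a * d) q q"
proof -
  let ?F = "\<lambda>z. Phi43 (q powi (- int n)) (a * b * c * d * q powi (int n - 1)) (a * z)
                (a * inverse z) (a * b) (a * c) (a * d) q q"
  define e where "e k = (\<Prod>j<k. [:1 + (a * q ^ j)\<^sup>2, - 2 * a * q ^ j:])" for k
  define C where "C k = qpoch (q powi (- int n)) q k * qpoch (a * b * c * d * q powi (int n - 1)) q k /
      (qpoch (a * b) q k * qpoch (a * c) q k * qpoch (a * d) q k * qpoch q q k) * q ^ k" for k
  define p where "p = (\<Sum>k\<le>n. smult (C k) (e k))"
  have e: "poly (e k) (xz w) = qpoch (a * w) q k * qpoch (a * inverse w) q k" if "w \<noteq> 0" for k w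
    unfolding e_def qpoch_def poly_prod prod.distrib[symmetric] using that
    by (intro prod.cong) (auto simp: xz_def field_simps power2_eq_square)
  have "poly p (xz w) = ?F w" if "w \<noteq> 0" for w
    unfolding p_def Phi43_terminates[OF q] poly_sum using that
    by (intro sum.cong) (auto simp: C_def e)
  then have ex: "\<forall>z. z \<noteq> 0 \<longrightarrow> poly p (xz z) = ?F z" by blast
  moreover have "r = p" if "\<forall>z. z \<noteq> 0 \<longrightarrow> poly r (xz z) = ?F z" for r
  proof (rule ccontr)
    assume "r \<noteq> p"
    then have "finite {x. poly (r - p) x = 0}" by (intro poly_roots_finite) simp
    moreover have "{xz z |z. z \<noteq> 0} \<subseteq> {x. poly (r - p) x = 0}"
      using that ex by auto
    ultimately show False using infinite_range_xz finite_subset by blast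
  qed
  ultimately have "\<forall>z. z \<noteq> 0 \<longrightarrow> poly (askey_wilson n a b c d q) (xz z) = ?F z"
    unfolding askey_wilson_def by (rule theI)
  with z show ?thesis by blast
qed

text \<open>
  The coefficients of \<open>H\<close> and \<open>L\<close> are rational functions; at their poles the value of an operator
  is an artefact of \<open>t / 0 = 0\<close>.
\<close>

type_synonym operator = "(real \<Rightarrow> complex) \<Rightarrow> real \<Rightarrow> complex"

definition Rop :: operator where
  "Rop f = (\<lambda>y. f (- y))"

definition Top :: "real \<Rightarrow> operator" where
  "Top h f = (\<lambda>y. f (y + h))"

definition bi_Phi1 :: "real \<Rightarrow> real \<Rightarrow> real \<Rightarrow> real" where
  "bi_Phi1 \<rho>1 \<rho>2 y = - (2 * (y - \<rho>1 - 1/4) * (y - \<rho>2 - 1/4) / (4 * y - 1))"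

definition bi_Phi2 :: "real \<Rightarrow> real \<Rightarrow> real \<Rightarrow> real" where
  "bi_Phi2 r1 r2 y = 2 * (y - r1 + 1/4) * (y - r2 + 1/4) / (4 * y + 1)"

definition bi_lambda :: "real \<Rightarrow> real \<Rightarrow> real \<Rightarrow> real \<Rightarrow> nat \<Rightarrow> real" where
  "bi_lambda r1 r2 \<rho>1 \<rho>2 n =
    (if even n then real n / 2 else r1 + r2 - \<rho>1 - \<rho>2 - (real n + 1) / 2)"

definition Hop :: "real \<Rightarrow> real \<Rightarrow> real \<Rightarrow> real \<Rightarrow> operator" where
  "Hop r1 r2 \<rho>1 \<rho>2 f = (\<lambda>y.
     of_real (bi_Phi1 \<rho>1 \<rho>2 y) * Top (- 1/2) (Rop f) y
   + of_real (bi_Phi2 r1 r2 y) * Top (1/2) (Rop f) y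
   - of_real (bi_Phi1 \<rho>1 \<rho>2 y + bi_Phi2 r1 r2 y) * f y)"

definition bi_F :: "real \<Rightarrow> real \<Rightarrow> real \<Rightarrow> real" where
  "bi_F \<rho>1 \<rho>2 y = (y - \<rho>1) * (y - \<rho>2) / (2 * y)"

definition bi_G :: "real \<Rightarrow> real \<Rightarrow> real \<Rightarrow> real" where
  "bi_G r1 r2 y = (y - r1 + 1/2) * (y - r2 + 1/2) / (2 * y + 1)"

definition Lop :: "real \<Rightarrow> real \<Rightarrow> real \<Rightarrow> real \<Rightarrow> operator" where
  "Lop r1 r2 \<rho>1 \<rho>2 f = (\<lambda>y.
     of_real (bi_F \<rho>1 \<rho>2 y) * (f y - Rop f y)
   + of_real (bi_G r1 r2 y) * (Top 1 (Rop f) y - f y))"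

text \<open>
  The eigenvalue equation is an identity of rational functions, hence imposed away from the poles
  \<open>0\<close> and \<open>-1/2\<close> of the coefficients of \<open>L\<close>.
\<close>

definition monic_bannai_ito :: "real \<Rightarrow> real \<Rightarrow> real \<Rightarrow> real \<Rightarrow> nat \<Rightarrow> real poly \<Rightarrow> bool" where
  "monic_bannai_ito r1 r2 \<rho>1 \<rho>2 n P \<longleftrightarrow>
    degree P = n \<and> lead_coeff P = 1 \<and>
    (\<forall>y. y \<noteq> 0 \<and> y \<noteq> - 1/2 \<longrightarrow>
      Lop r1 r2 \<rho>1 \<rho>2 (\<lambda>t. of_real (poly P t)) y = of_real (bi_lambda r1 r2 \<rho>1 \<rho>2 n * poly P y))"

end

theory Submission
  imports Defs
begin

text \<open>
  The theorem combines an algebraic fact, the Askey-Wilson difference equation, with a limit in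
  which everything happens factor by factor.

  The Askey-Wilson operator maps the basis function \<open>(a z)\<^sub>k (a z\<inverse>)\<^sub>k\<close> to a combination of itself and
  its predecessor (\<open>aw_operator_basis\<close>). The polynomial \<open>R\<^sub>n\<close> is a combination of these functions, and
  its coefficients satisfy the two-term recurrence (\<open>aw_ratio_recurrence\<close>) that makes it an
  eigenfunction with eigenvalue \<open>\<Lambda>\<^sub>n\<close> (\<open>askey_wilson_difference_equation\<close>).

  With the given parameters, every factor of the hypergeometric terms, of \<open>\<Omega>\<close>, of \<open>\<Lambda>\<^sub>n\<close> and of
  \<open>1 + q\<close> has the form \<open>1 - (-1)\<^sup>m e\<^bsup>\<epsilon>x\<^esup>\<close>. It tends to \<open>2\<close> if \<open>m\<close> is odd, and behaves like \<open>-\<epsilon>x\<close> if \<open>m\<close> is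
  even (\<open>sexp_factor_limit\<close>). In each of these quotients the number of factors of the second kind
  is the same above and below, so that the powers of \<open>\<epsilon>\<close> cancel and the limit is the quotient of the
  leading coefficients (\<open>bi_factor_limit\<close>, \<open>aw_Omega_limit\<close>, \<open>bi_Lambda_limit\<close>). The limit of \<open>R\<^sub>n\<close> is
  thus a sum of products of linear factors in \<open>y\<close>, and it has degree \<open>n\<close> because the nondegeneracy
  condition keeps all coefficients up to index \<open>n\<close> away from zero (\<open>degree_bi_limit\<close>).

  The \<open>q\<close>-shifts become reflections because \<open>zq\<close> and \<open>zq\<inverse>\<close> are the inverses of the points belonging to
  \<open>-y + 1/2\<close> and \<open>-y - 1/2\<close> (\<open>bi_z_mult_q\<close>, \<open>bi_z_div_q\<close>), while \<open>x(z) = x(z\<inverse>)\<close>. Passing to the limit in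
  the difference equation gives the eigenvalue equation for \<open>H\<close>; conjugating with a translation by
  \<open>1/4\<close> (\<open>Lop_conjugate\<close>) gives the one for \<open>L\<close>, which identifies the monic limit polynomial
  (\<open>monic_bannai_ito_shift\<close>).
\<close>

section \<open>The Askey-Wilson difference equation\<close>

definition aw_basis :: "complex \<Rightarrow> complex \<Rightarrow> nat \<Rightarrow> complex \<Rightarrow> complex" where
  "aw_basis a q k z = qpoch (a * z) q k * qpoch (a * inverse z) q k"

definition aw_ratio ::
  "nat \<Rightarrow> complex \<Rightarrow> complex \<Rightarrow> complex \<Rightarrow> complex \<Rightarrow> complex \<Rightarrow> nat \<Rightarrow> complex" where
  "aw_ratio n a b c d q j =
    (1 - q powi (- int n) * q ^ j) * (1 - a * b * c * d * q powi (int n - 1) * q ^ j) * q /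
    ((1 - a * b * q ^ j) * (1 - a * c * q ^ j) * (1 - a * d * q ^ j) * (1 - q * q ^ j))"

lemma poly_askey_wilson_basis:
  assumes "q \<noteq> 0" "z \<noteq> 0"
  shows "poly (askey_wilson n a b c d q) (xz z) =
    (\<Sum>k\<le>n. (\<Prod>j<k. aw_ratio n a b c d q j) * aw_basis a q k z)"
  unfolding poly_askey_wilson[OF assms] Phi43_terminates[OF assms(1)]
  by (intro sum.cong refl)
    (simp add: aw_ratio_def aw_basis_def qpoch_def prod.distrib prod_dividef)

lemma aw_basis_inverse: "aw_basis a q k (inverse z) = aw_basis a q k z"
  by (simp add: aw_basis_def)

lemma qpoch_Suc: "qpoch a q (Suc k) = qpoch a q k * (1 - a * q ^ k)"
  by (simp add: qpoch_def)

lemma qpoch_shift: "qpoch a q (Suc k) = (1 - a) * qpoch (a * q) q k"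
  unfolding qpoch_def prod.lessThan_Suc_shift by (simp add: mult.assoc)

text \<open>
  The factor \<open>1 - a z\<close> of \<open>\<Omega>(z)\<close> turns \<open>(a z q)\<^sub>k\<close> into \<open>(a z)\<^sub>k\<^sub>+\<^sub>1\<close>, so that everything becomes a
  multiple of the basis function of index \<open>k\<close>. The remaining bracket contains \<open>1 - q z\<^sup>2\<close>, which
  cancels the pole of \<open>\<Omega>\<close> that is not symmetric under \<open>z \<rightarrow> z\<inverse>\<close>.
\<close>

lemma aw_Omega_shift_basis:
  assumes "q \<noteq> 0" "z \<noteq> 0" "z\<^sup>2 \<noteq> 1" "q * z\<^sup>2 \<noteq> 1"
  shows "aw_Omega a b c d q z * (aw_basis a q (Suc k) (z * q) - aw_basis a q (Suc k) z) =
    - (1 - q * q ^ k) * a / q * aw_basis a q k z *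
      ((1 - a * q ^ k * z) * (1 - b * z) * (1 - c * z) * (1 - d * z) / (z * (1 - z\<^sup>2)))"
proof -
  define Q u v where "Q = q ^ k" and "u = qpoch (a * z) q k" and "v = qpoch (a * inverse z) q k"
  have up: "(1 - a * z) * qpoch (a * (z * q)) q k = u * (1 - a * z * Q)"
    using qpoch_shift[of "a * z" q k] qpoch_Suc[of "a * z" q k] by (simp add: u_def Q_def mult.assoc)
  have down: "qpoch (a * inverse (z * q)) q (Suc k) = (1 - a * inverse (z * q)) * v"
    using qpoch_shift[of "a * inverse (z * q)" q k] assms by (simp add: v_def mult.assoc)
  have "(1 - a * z) * (aw_basis a q (Suc k) (z * q) - aw_basis a q (Suc k) z) =
      ((1 - a * z) * qpoch (a * (z * q)) q k) * (1 - a * (z * q) * Q) * (1 - a * inverse (z * q)) * v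
      - (1 - a * z) * (u * (1 - a * z * Q)) * (v * (1 - a * inverse z * Q))"
    unfolding aw_basis_def down unfolding qpoch_Suc u_def v_def Q_def by algebra
  also have "\<dots> = u * v * (1 - a * z * Q) *
      ((1 - a * (z * q) * Q) * (1 - a * inverse (z * q)) - (1 - a * z) * (1 - a * inverse z * Q))"
    unfolding up by algebra
  also have "(1 - a * (z * q) * Q) * (1 - a * inverse (z * q)) - (1 - a * z) * (1 - a * inverse z * Q) =
      - (1 - q * Q) * a / (q * z) * (1 - q * z\<^sup>2)"
    using assms by (simp add: field_simps power2_eq_square)
  finally have diff: "(1 - a * z) * (aw_basis a q (Suc k) (z * q) - aw_basis a q (Suc k) z) =
      u * v * (1 - a * z * Q) * (- (1 - q * Q) * a / (q * z) * (1 - q * z\<^sup>2))" .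
  have "aw_Omega a b c d q z * (aw_basis a q (Suc k) (z * q) - aw_basis a q (Suc k) z) =
      ((1 - a * z) * (aw_basis a q (Suc k) (z * q) - aw_basis a q (Suc k) z)) *
      ((1 - b * z) * (1 - c * z) * (1 - d * z) / ((1 - z\<^sup>2) * (1 - q * z\<^sup>2)))"
    by (simp add: aw_Omega_def)
  also have "\<dots> = - (1 - q * Q) * a / q * (u * v) *
      ((1 - a * Q * z) * (1 - b * z) * (1 - c * z) * (1 - d * z) / (z * (1 - z\<^sup>2)))"
    using assms unfolding diff by (simp add: divide_simps)
  finally show ?thesis by (simp add: u_def v_def Q_def aw_basis_def)
qed

text \<open>
  Adding to the right-hand side of the preceding lemma its image under \<open>z \<rightarrow> z\<inverse>\<close> removes the
  denominator \<open>1 - z\<^sup>2\<close> too: the numerator is antisymmetric under this reflection. What remains is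
  an affine function of \<open>(1 - a Q z)(1 - a Q z\<inverse>)\<close>, and hence a combination of two consecutive basis functions.
\<close>

lemma aw_antisymmetrisation:
  fixes a b c d z :: complex
  assumes "z \<noteq> 0" "z\<^sup>2 \<noteq> 1" "Q \<noteq> 0"
  shows "a * ((1 - a * Q * z) * (1 - b * z) * (1 - c * z) * (1 - d * z) / (z * (1 - z\<^sup>2)) +
     (1 - a * Q * inverse z) * (1 - b * inverse z) * (1 - c * inverse z) * (1 - d * inverse z) /
     (inverse z * (1 - (inverse z)\<^sup>2))) =
   - ((1 - a * b * c * d * Q) * ((1 - a * z * Q) * (1 - a * inverse z * Q))
     - (1 - a * b * Q) * (1 - a * c * Q) * (1 - a * d * Q)) / Q"
proof -
  \<comment> \<open>After clearing denominators the claim is the polynomial identity \<open>key\<close> below.\<close>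
  define N M where "N = (1 - a * Q * z) * (1 - b * z) * (1 - c * z) * (1 - d * z)"
    and "M = (z - a * Q) * (z - b) * (z - c) * (z - d)"
  have M: "(1 - a * Q * inverse z) * (1 - b * inverse z) * (1 - c * inverse z) * (1 - d * inverse z) /
     (inverse z * (1 - (inverse z)\<^sup>2)) = - M / (z * (1 - z\<^sup>2))"
  proof -
    have "(1 - a * Q * inverse z) * (1 - b * inverse z) * (1 - c * inverse z) * (1 - d * inverse z) = M / z ^ 4"
      unfolding M_def using assms by (simp add: field_simps power4_eq_xxxx)
    moreover have "inverse z * (1 - (inverse z)\<^sup>2) = - (z * (1 - z\<^sup>2)) / z ^ 4"
      using assms by (simp add: field_simps power2_eq_square power4_eq_xxxx)
    ultimately show ?thesis using assms by simp
  qed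
  define X where "X = (1 - a * b * c * d * Q) * ((1 - a * z * Q) * (z - a * Q))
     - z * (1 - a * b * Q) * (1 - a * c * Q) * (1 - a * d * Q)"
  have X: "(1 - a * b * c * d * Q) * ((1 - a * z * Q) * (1 - a * inverse z * Q))
     - (1 - a * b * Q) * (1 - a * c * Q) * (1 - a * d * Q) = X / z"
    unfolding X_def using assms by (simp add: field_simps)
  have key: "a * Q * (N - M) = - (1 - z\<^sup>2) * X"
    unfolding N_def M_def X_def by algebra
  show ?thesis unfolding M X N_def[symmetric]
    using assms key by (simp add: divide_simps) (simp add: algebra_simps)
qed

text \<open>
  The Askey-Wilson operator is bidiagonal in the basis \<open>(a z)\<^sub>k (a z\<inverse>)\<^sub>k\<close>, with the eigenvalues on
  the diagonal. This reduces the difference equation to a two-term recurrence for coefficients.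
\<close>

lemma aw_operator_basis:
  assumes "q \<noteq> 0" "z \<noteq> 0" "z\<^sup>2 \<noteq> 1" "q * z\<^sup>2 \<noteq> 1" "z\<^sup>2 \<noteq> q"
  shows "aw_Omega a b c d q z * (aw_basis a q (Suc k) (z * q) - aw_basis a q (Suc k) z)
     + aw_Omega a b c d q (inverse z) *
         (aw_basis a q (Suc k) (z * inverse q) - aw_basis a q (Suc k) z) =
     aw_Lambda (Suc k) a b c d q * aw_basis a q (Suc k) z
     - (1 - q * q ^ k) * (1 - a * b * q ^ k) * (1 - a * c * q ^ k) * (1 - a * d * q ^ k) /
         (q * q ^ k) * aw_basis a q k z"
proof -
  define Q where "Q = q ^ k"
  have Q: "Q \<noteq> 0" using assms by (simp add: Q_def)
  have inv: "inverse z \<noteq> 0" "(inverse z)\<^sup>2 \<noteq> 1" "q * (inverse z)\<^sup>2 \<noteq> 1"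
    using assms by (auto simp: field_simps)
  have "aw_basis a q (Suc k) (inverse z * q) = aw_basis a q (Suc k) (z * inverse q)"
    using aw_basis_inverse[of a q "Suc k" "z * inverse q"] by (simp add: mult.commute)
  then have reflected: "aw_Omega a b c d q (inverse z) *
         (aw_basis a q (Suc k) (z * inverse q) - aw_basis a q (Suc k) z) =
      - (1 - q * q ^ k) * a / q * aw_basis a q k z *
      ((1 - a * q ^ k * inverse z) * (1 - b * inverse z) * (1 - c * inverse z) * (1 - d * inverse z) /
        (inverse z * (1 - (inverse z)\<^sup>2)))"
    using aw_Omega_shift_basis[OF assms(1) inv, of a b c d k] by (simp only: aw_basis_inverse)
  have Lam: "aw_Lambda (Suc k) a b c d q = (1 - q * Q) / (q * Q) * (1 - a * b * c * d * Q)"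
  proof -
    have "q powi (- int (Suc k)) = 1 / (q * Q)"
      unfolding Q_def power_int_minus power_int_of_nat by (simp add: inverse_eq_divide)
    then show ?thesis using assms(1) Q by (simp add: aw_Lambda_def Q_def diff_divide_distrib)
  qed
  have basis: "aw_basis a q (Suc k) z =
      aw_basis a q k z * ((1 - a * z * Q) * (1 - a * inverse z * Q))"
    by (simp add: aw_basis_def qpoch_Suc Q_def)
  have "aw_Omega a b c d q z * (aw_basis a q (Suc k) (z * q) - aw_basis a q (Suc k) z)
     + aw_Omega a b c d q (inverse z) *
         (aw_basis a q (Suc k) (z * inverse q) - aw_basis a q (Suc k) z) =
     - (1 - q * Q) / q * aw_basis a q k z *
     (a * ((1 - a * Q * z) * (1 - b * z) * (1 - c * z) * (1 - d * z) / (z * (1 - z\<^sup>2)) +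
     (1 - a * Q * inverse z) * (1 - b * inverse z) * (1 - c * inverse z) * (1 - d * inverse z) /
     (inverse z * (1 - (inverse z)\<^sup>2))))"
    unfolding reflected aw_Omega_shift_basis[OF assms(1-4)] Q_def[symmetric]
    by (simp only: distrib_left times_divide_eq_left times_divide_eq_right mult.assoc mult.commute mult.left_commute)
  also have "\<dots> = aw_Lambda (Suc k) a b c d q * aw_basis a q (Suc k) z
     - (1 - q * Q) * (1 - a * b * Q) * (1 - a * c * Q) * (1 - a * d * Q) / (q * Q) * aw_basis a q k z"
    unfolding aw_antisymmetrisation[OF assms(2,3) Q] Lam basis
    using assms(1,2) Q by (simp add: divide_simps) algebra
  finally show ?thesis by (simp only: Q_def)
qed

text \<open>
  The two-term recurrence that makes a combination of the basis functions an eigenfunction for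
  \<open>\<Lambda>\<^sub>n\<close>: up to a power of \<open>q\<close>, the difference of two eigenvalues factors into the
  numerator of the hypergeometric term ratio.
\<close>

lemma aw_ratio_recurrence:
  assumes "q \<noteq> 0"
    and "1 - a * b * q ^ k \<noteq> 0" "1 - a * c * q ^ k \<noteq> 0" "1 - a * d * q ^ k \<noteq> 0" "1 - q * q ^ k \<noteq> 0"
  shows "aw_ratio n a b c d q k *
      ((1 - q * q ^ k) * (1 - a * b * q ^ k) * (1 - a * c * q ^ k) * (1 - a * d * q ^ k) / (q * q ^ k)) =
    aw_Lambda k a b c d q - aw_Lambda n a b c d q"
proof -
  have "aw_ratio n a b c d q k *
      ((1 - q * q ^ k) * (1 - a * b * q ^ k) * (1 - a * c * q ^ k) * (1 - a * d * q ^ k) / (q * q ^ k)) =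
    (1 - q powi (- int n) * q ^ k) * (1 - a * b * c * d * q powi (int n - 1) * q ^ k) / q ^ k"
    using assms unfolding aw_ratio_def by (simp only: divide_simps) simp
  also have "\<dots> = aw_Lambda k a b c d q - aw_Lambda n a b c d q"
    using assms(1) unfolding aw_Lambda_def
    by (simp add: power_int_minus power_int_diff field_simps)
  finally show ?thesis .
qed

lemma askey_wilson_difference_equation:
  assumes def: "askey_wilson_defined n a b c d q"
    and z: "z \<noteq> 0" "z\<^sup>2 \<noteq> 1" "q * z\<^sup>2 \<noteq> 1" "z\<^sup>2 \<noteq> q"
  defines "R \<equiv> \<lambda>w. poly (askey_wilson n a b c d q) (xz w)"
  shows "aw_Omega a b c d q z * R (z * q) + aw_Omega a b c d q (inverse z) * R (z * inverse q)
     - (aw_Omega a b c d q z + aw_Omega a b c d q (inverse z)) * R z = aw_Lambda n a b c d q * R z"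
proof -
  have q: "q \<noteq> 0" using def by (simp add: askey_wilson_defined_def)
  define C where "C k = (\<Prod>j<k. aw_ratio n a b c d q j)" for k
  define e where "e k = aw_basis a q k z" for k
  define \<mu> where "\<mu> k = aw_Lambda k a b c d q" for k
  define D where "D k = aw_Omega a b c d q z * (aw_basis a q k (z * q) - aw_basis a q k z)
     + aw_Omega a b c d q (inverse z) * (aw_basis a q k (z * inverse q) - aw_basis a q k z)" for k
  have R: "R w = (\<Sum>k\<le>n. C k * aw_basis a q k w)" if "w \<noteq> 0" for w
    unfolding R_def C_def by (rule poly_askey_wilson_basis[OF q that])
  have D0: "D 0 = 0" by (simp add: D_def aw_basis_def qpoch_def)
  have mu0: "\<mu> 0 = 0" by (simp add: \<mu>_def aw_Lambda_def)
  have step: "C (Suc k) * D (Suc k) = C (Suc k) * \<mu> (Suc k) * e (Suc k) + (\<mu> n - \<mu> k) * C k * e k"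
    if "k < n" for k
  proof -
    have "qpoch (a * b) q (Suc k) \<noteq> 0" "qpoch (a * c) q (Suc k) \<noteq> 0" "qpoch (a * d) q (Suc k) \<noteq> 0"
        "qpoch q q (Suc k) \<noteq> 0"
      using def that by (auto simp: askey_wilson_defined_def)
    then have nz: "1 - a * b * q ^ k \<noteq> 0" "1 - a * c * q ^ k \<noteq> 0" "1 - a * d * q ^ k \<noteq> 0" "1 - q * q ^ k \<noteq> 0"
      by (auto simp: qpoch_Suc)
    define \<nu> where "\<nu> = (1 - q * q ^ k) * (1 - a * b * q ^ k) * (1 - a * c * q ^ k) * (1 - a * d * q ^ k) / (q * q ^ k)"
    have "aw_ratio n a b c d q k * \<nu> = \<mu> k - \<mu> n"
      unfolding \<nu>_def \<mu>_def by (rule aw_ratio_recurrence[OF q nz])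
    then have "C (Suc k) * \<nu> = (\<mu> k - \<mu> n) * C k" by (simp add: C_def mult.assoc mult.commute)
    moreover have "D (Suc k) = \<mu> (Suc k) * e (Suc k) - \<nu> * e k"
      unfolding D_def \<mu>_def e_def \<nu>_def by (rule aw_operator_basis[OF q z])
    ultimately show ?thesis by algebra
  qed
  have tele: "(\<Sum>k\<le>m. C k * D k) = (\<Sum>k\<le>m. \<mu> k * (C k * e k)) + (\<Sum>k<m. (\<mu> n - \<mu> k) * (C k * e k))"
    if "m \<le> n" for m
    using that by (induction m) (auto simp: D0 mu0 step algebra_simps)
  have "aw_Omega a b c d q z * R (z * q) + aw_Omega a b c d q (inverse z) * R (z * inverse q)
     - (aw_Omega a b c d q z + aw_Omega a b c d q (inverse z)) * R z = (\<Sum>k\<le>n. C k * D k)"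
    using z q by (simp add: R D_def sum_distrib_left sum_subtractf[symmetric] sum.distrib[symmetric] algebra_simps)
  \<comment> \<open>The second sum may include \<open>k = n\<close>, because its coefficient \<open>\<mu> n - \<mu> n\<close> vanishes.\<close>
  also have "\<dots> = (\<Sum>k\<le>n. \<mu> k * (C k * e k)) + (\<Sum>k\<le>n. (\<mu> n - \<mu> k) * (C k * e k))"
    using tele[of n] by (simp add: lessThan_Suc_atMost[symmetric])
  also have "\<dots> = \<mu> n * R z"
    using z by (simp add: R e_def sum_distrib_left sum.distrib[symmetric] algebra_simps)
  finally show ?thesis by (simp add: \<mu>_def)
qed

section \<open>Signed exponentials\<close>

text \<open>
  Near \<open>q = -1\<close> all Pochhammer factors have the form \<open>1 - (-1)\<^sup>m e\<^bsup>\<epsilon>x\<^esup>\<close>. Only the parity of \<open>m\<close>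
  matters, but keeping it as a natural number makes multiplication additive in both arguments.
\<close>

definition sexp :: "real \<Rightarrow> nat \<Rightarrow> real \<Rightarrow> complex" where
  "sexp \<epsilon> m x = (- 1) ^ m * exp (of_real (\<epsilon> * x))"

definition vanishing_order_weight :: "real \<Rightarrow> nat \<Rightarrow> complex" where
  "vanishing_order_weight \<epsilon> m = (if even m then of_real \<epsilon> else 1)"

text \<open>
  The first nonzero Taylor coefficient at \<open>\<epsilon> = 0\<close> of such a factor (if \<open>x \<noteq> 0\<close>); the preceding
  weight records whether it belongs to \<open>\<epsilon>\<close> or to the constant term.
\<close>

definition leading :: "nat \<Rightarrow> real \<Rightarrow> real" where
  "leading m x = (if even m then - x else 2)"

lemma sexp_mult: "sexp \<epsilon> m x * sexp \<epsilon> k y = sexp \<epsilon> (m + k) (x + y)"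
  by (simp add: sexp_def power_add exp_add[symmetric] algebra_simps)

lemma sexp_nonzero: "sexp \<epsilon> m x \<noteq> 0"
  by (simp add: sexp_def)

lemma sexp_cong: "even m = even k \<Longrightarrow> sexp \<epsilon> m x = sexp \<epsilon> k x"
  by (simp add: sexp_def minus_one_power_iff)

lemma sexp_power: "sexp \<epsilon> m x ^ j = sexp \<epsilon> (m * j) (x * real j)"
  by (simp add: sexp_def power_mult_distrib power_mult[symmetric] exp_of_nat_mult[symmetric] algebra_simps)

lemma sexp_inverse: "inverse (sexp \<epsilon> m x) = sexp \<epsilon> m (- x)"
  by (simp add: sexp_def exp_minus inverse_mult_distrib power_inverse[symmetric])

lemma sexp_ne_1:
  assumes "\<epsilon> \<noteq> 0" "odd m \<or> x \<noteq> 0"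
  shows "sexp \<epsilon> m x \<noteq> 1"
proof -
  have "sexp \<epsilon> m x = of_real ((- 1) ^ m * exp (\<epsilon> * x))"
    unfolding sexp_def exp_of_real by simp
  moreover have "(- 1) ^ m * exp (\<epsilon> * x) \<noteq> 1"
    using assms exp_gt_zero[of "\<epsilon> * x"] by (cases "even m") (auto simp del: exp_gt_zero)
  ultimately show ?thesis by (metis of_real_eq_1_iff)
qed

text \<open>
  For even \<open>m\<close> a factor with \<open>x = 0\<close> vanishes identically in \<open>\<epsilon>\<close>. This is why being defined for a
  single \<open>\<epsilon>\<close> already prevents the denominators from degenerating in the limit.
\<close>

lemma leading_nonzero:
  assumes "1 - sexp \<epsilon> m x \<noteq> 0"
  shows "leading m x \<noteq> 0"
  using assms by (auto simp: sexp_def leading_def)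

lemma sexp_limit: "((\<lambda>\<epsilon>. sexp \<epsilon> m x) \<longlongrightarrow> (- 1) ^ m) (at 0)"
proof -
  have "isCont (\<lambda>\<epsilon>. sexp \<epsilon> m x) 0" unfolding sexp_def by (intro continuous_intros)
  then show ?thesis by (simp add: isCont_def sexp_def)
qed

lemma sexp_factor_limit:
  "((\<lambda>\<epsilon>. (1 - sexp \<epsilon> m x) / vanishing_order_weight \<epsilon> m) \<longlongrightarrow> of_real (leading m x)) (at 0)"
proof (cases "even m")
  case True
  have "((\<lambda>\<epsilon>. 1 - exp (\<epsilon> * x)) has_real_derivative - x) (at 0)"
    by (auto intro!: derivative_eq_intros)
  then have "((\<lambda>\<epsilon>. (1 - exp (\<epsilon> * x)) / \<epsilon>) \<longlongrightarrow> - x) (at 0)"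
    by (simp add: has_field_derivative_iff)
  from tendsto_of_real[OF this, where 'a = complex] show ?thesis
    unfolding sexp_def exp_of_real using True by (simp add: vanishing_order_weight_def leading_def)
next
  case False
  have "((\<lambda>\<epsilon>. 1 - sexp \<epsilon> m x) \<longlongrightarrow> 1 - (- 1) ^ m) (at 0)"
    by (intro tendsto_intros sexp_limit)
  then show ?thesis using False by (simp add: vanishing_order_weight_def leading_def)
qed

section \<open>The parameters near minus one\<close>

definition bi_q :: "real \<Rightarrow> complex" where
  "bi_q \<epsilon> = - exp (of_real \<epsilon>)"

definition bi_ab :: "real \<Rightarrow> real \<Rightarrow> complex" where
  "bi_ab \<rho> \<epsilon> = - \<i> * exp (of_real (\<epsilon> * (2 * \<rho> + 1/2)))"

definition bi_cd :: "real \<Rightarrow> real \<Rightarrow> complex" where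
  "bi_cd r \<epsilon> = \<i> * exp (of_real (\<epsilon> * (- 2 * r + 1/2)))"

definition bi_z :: "real \<Rightarrow> real \<Rightarrow> complex" where
  "bi_z \<epsilon> y = \<i> * exp (of_real (- 2 * \<epsilon> * y))"

lemma bi_q_sexp: "bi_q \<epsilon> = sexp \<epsilon> 1 1"
  by (simp add: bi_q_def sexp_def)

lemma i_exp_mult:
  "(- \<i> * exp (of_real (\<epsilon> * x))) * (- \<i> * exp (of_real (\<epsilon> * y))) = sexp \<epsilon> 1 (x + y)"
  "(- \<i> * exp (of_real (\<epsilon> * x))) * (\<i> * exp (of_real (\<epsilon> * y))) = sexp \<epsilon> 0 (x + y)"
  "(\<i> * exp (of_real (\<epsilon> * x))) * (- \<i> * exp (of_real (\<epsilon> * y))) = sexp \<epsilon> 0 (x + y)"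
  "(\<i> * exp (of_real (\<epsilon> * x))) * (\<i> * exp (of_real (\<epsilon> * y))) = sexp \<epsilon> 1 (x + y)"
proof -
  have "(\<i> * u) * (\<i> * v) = - (u * v)" for u v
    using i_squared by algebra
  then show
    "(- \<i> * exp (of_real (\<epsilon> * x))) * (- \<i> * exp (of_real (\<epsilon> * y))) = sexp \<epsilon> 1 (x + y)"
    "(- \<i> * exp (of_real (\<epsilon> * x))) * (\<i> * exp (of_real (\<epsilon> * y))) = sexp \<epsilon> 0 (x + y)"
    "(\<i> * exp (of_real (\<epsilon> * x))) * (- \<i> * exp (of_real (\<epsilon> * y))) = sexp \<epsilon> 0 (x + y)"
    "(\<i> * exp (of_real (\<epsilon> * x))) * (\<i> * exp (of_real (\<epsilon> * y))) = sexp \<epsilon> 1 (x + y)"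
    by (simp_all add: sexp_def exp_add distrib_left)
qed

lemma bi_z_exp: "bi_z \<epsilon> y = \<i> * exp (of_real (\<epsilon> * (- 2 * y)))"
  by (simp add: bi_z_def algebra_simps)

lemma inverse_bi_z: "inverse (bi_z \<epsilon> y) = - \<i> * exp (of_real (\<epsilon> * (2 * y)))"
  unfolding bi_z_exp by (simp add: exp_minus)

lemma bi_products:
  "bi_ab \<rho> \<epsilon> * bi_ab \<rho>' \<epsilon> = sexp \<epsilon> 1 (2 * \<rho> + 2 * \<rho>' + 1)"
  "bi_ab \<rho> \<epsilon> * bi_cd r \<epsilon> = sexp \<epsilon> 0 (2 * \<rho> - 2 * r + 1)"
  "bi_cd r \<epsilon> * bi_cd r' \<epsilon> = sexp \<epsilon> 1 (1 - 2 * r - 2 * r')"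
  "bi_ab \<rho> \<epsilon> * bi_z \<epsilon> y = sexp \<epsilon> 0 (2 * \<rho> + 1/2 - 2 * y)"
  "bi_ab \<rho> \<epsilon> * inverse (bi_z \<epsilon> y) = sexp \<epsilon> 1 (2 * \<rho> + 1/2 + 2 * y)"
  "bi_cd r \<epsilon> * bi_z \<epsilon> y = sexp \<epsilon> 1 (1/2 - 2 * r - 2 * y)"
  "bi_cd r \<epsilon> * inverse (bi_z \<epsilon> y) = sexp \<epsilon> 0 (1/2 - 2 * r + 2 * y)"
  "(bi_z \<epsilon> y)\<^sup>2 = sexp \<epsilon> 1 (- 4 * y)"
  "(inverse (bi_z \<epsilon> y))\<^sup>2 = sexp \<epsilon> 1 (4 * y)"
  unfolding inverse_bi_z unfolding bi_ab_def bi_cd_def bi_z_exp power2_eq_square i_exp_mult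
  by (simp_all add: algebra_simps)

lemma bi_z_nonzero: "bi_z \<epsilon> y \<noteq> 0"
  by (simp add: bi_z_def)

text \<open>
  Since \<open>x(z)\<close> does not distinguish \<open>z\<close> from \<open>z\<inverse>\<close>, these two identities turn the \<open>q\<close>-shifts into
  reflections of \<open>y\<close> already before the limit; this is the origin of the Dunkl type operators.
\<close>

lemma bi_z_mult_q: "bi_z \<epsilon> y * bi_q \<epsilon> = inverse (bi_z \<epsilon> (- y + 1/2))"
proof -
  have arg: "\<epsilon> * (2 * (- y + 1/2)) = \<epsilon> * (- 2 * y) + \<epsilon>" by (simp add: algebra_simps)
  show ?thesis
    unfolding inverse_bi_z arg unfolding of_real_add exp_add bi_z_exp bi_q_def by simp
qed

lemma bi_z_div_q: "bi_z \<epsilon> y * inverse (bi_q \<epsilon>) = inverse (bi_z \<epsilon> (- y - 1/2))"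
proof -
  have arg: "\<epsilon> * (2 * (- y - 1/2)) = \<epsilon> * (- 2 * y) - \<epsilon>" by (simp add: algebra_simps)
  show ?thesis
    unfolding inverse_bi_z arg unfolding of_real_diff exp_diff bi_z_exp bi_q_def
    by (simp add: field_simps)
qed

lemma xz_inverse: "xz (inverse z) = xz z"
  by (simp add: xz_def)

lemma bi_q_powers:
  "bi_q \<epsilon> ^ j = sexp \<epsilon> j (real j)"
  "bi_q \<epsilon> powi (- int n) = sexp \<epsilon> n (- real n)"
  "bi_q \<epsilon> powi (int n - 1) = sexp \<epsilon> (n + 1) (real n - 1)"
proof -
  show *: "bi_q \<epsilon> ^ j = sexp \<epsilon> j (real j)" for j
    by (simp add: bi_q_sexp sexp_power)
  show "bi_q \<epsilon> powi (- int n) = sexp \<epsilon> n (- real n)"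
    by (simp add: power_int_minus * sexp_inverse)
  have "bi_q \<epsilon> powi (int n - 1) = bi_q \<epsilon> ^ n * inverse (bi_q \<epsilon>)"
    using sexp_nonzero[of \<epsilon> 1 1] by (simp add: power_int_diff bi_q_sexp field_simps)
  then show "bi_q \<epsilon> powi (int n - 1) = sexp \<epsilon> (n + 1) (real n - 1)"
    unfolding * unfolding bi_q_sexp sexp_inverse sexp_mult by simp
qed

lemma bi_abcd:
  "bi_ab \<rho>1 \<epsilon> * bi_ab \<rho>2 \<epsilon> * bi_cd r2 \<epsilon> * bi_cd r1 \<epsilon> =
     sexp \<epsilon> 0 (2 * (\<rho>1 + \<rho>2 - r1 - r2) + 2)"
proof -
  have "bi_ab \<rho>1 \<epsilon> * bi_ab \<rho>2 \<epsilon> * bi_cd r2 \<epsilon> * bi_cd r1 \<epsilon> =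
      sexp \<epsilon> 2 (2 * \<rho>1 + 2 * \<rho>2 + 1 + (1 - 2 * r2 - 2 * r1))"
    by (simp only: mult.assoc[of _ "bi_cd r2 \<epsilon>"] bi_products sexp_mult one_add_one)
  also have "\<dots> = sexp \<epsilon> 0 (2 * (\<rho>1 + \<rho>2 - r1 - r2) + 2)"
    by (simp add: sexp_cong[of 2 0] algebra_simps)
  finally show ?thesis .
qed

lemma one_plus_bi_q: "1 + bi_q \<epsilon> = 1 - sexp \<epsilon> 0 1"
  by (simp add: bi_q_def sexp_def)

lemma bi_ratio_sexp:
  "aw_ratio n (bi_ab \<rho>1 \<epsilon>) (bi_ab \<rho>2 \<epsilon>) (bi_cd r2 \<epsilon>) (bi_cd r1 \<epsilon>) (bi_q \<epsilon>) j =
    (1 - sexp \<epsilon> (n + j) (real j - real n)) *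
    (1 - sexp \<epsilon> (n + j + 1) (2 * (\<rho>1 + \<rho>2 - r1 - r2) + real n + real j + 1)) * sexp \<epsilon> 1 1 /
    ((1 - sexp \<epsilon> (j + 1) (2 * \<rho>1 + 2 * \<rho>2 + real j + 1)) * (1 - sexp \<epsilon> j (2 * \<rho>1 - 2 * r2 + real j + 1)) *
     (1 - sexp \<epsilon> j (2 * \<rho>1 - 2 * r1 + real j + 1)) * (1 - sexp \<epsilon> (j + 1) (real j + 1)))"
proof -
  have args:
    "sexp \<epsilon> (n + j) (- real n + real j) = sexp \<epsilon> (n + j) (real j - real n)"
    "sexp \<epsilon> (0 + (n + 1) + j) (2 * (\<rho>1 + \<rho>2 - r1 - r2) + 2 + (real n - 1) + real j) =
      sexp \<epsilon> (n + j + 1) (2 * (\<rho>1 + \<rho>2 - r1 - r2) + real n + real j + 1)"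
    "sexp \<epsilon> (1 + j) (2 * \<rho>1 + 2 * \<rho>2 + 1 + real j) = sexp \<epsilon> (j + 1) (2 * \<rho>1 + 2 * \<rho>2 + real j + 1)"
    "sexp \<epsilon> (0 + j) (2 * \<rho>1 - 2 * r + 1 + real j) = sexp \<epsilon> j (2 * \<rho>1 - 2 * r + real j + 1)"
    "sexp \<epsilon> (1 + j) (1 + real j) = sexp \<epsilon> (j + 1) (real j + 1)" for r
    by (simp_all add: algebra_simps)
  show ?thesis
    unfolding aw_ratio_def bi_abcd unfolding bi_products bi_q_powers unfolding bi_q_sexp sexp_mult args ..
qed

section \<open>Termwise limit of the hypergeometric sum\<close>

text \<open>
  The coefficients and nodes of the limit: in the term ratio every Pochhammer factor is replaced by
  its leading coefficient, and the argument \<open>q\<close> of the series by \<open>-1\<close>.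
\<close>

definition limit_ratio :: "real \<Rightarrow> real \<Rightarrow> real \<Rightarrow> real \<Rightarrow> nat \<Rightarrow> nat \<Rightarrow> real" where
  "limit_ratio r1 r2 \<rho>1 \<rho>2 n j =
    - (leading (n + j) (real j - real n) *
       leading (n + j + 1) (2 * (\<rho>1 + \<rho>2 - r1 - r2) + real n + real j + 1)) /
    (leading (j + 1) (2 * \<rho>1 + 2 * \<rho>2 + real j + 1) * leading j (2 * \<rho>1 - 2 * r2 + real j + 1) *
     leading j (2 * \<rho>1 - 2 * r1 + real j + 1) * leading (j + 1) (real j + 1))"

definition limit_node :: "real \<Rightarrow> nat \<Rightarrow> real poly" where
  "limit_node \<rho>1 j = [: - 2 * (2 * \<rho>1 + 1/2 + real j), 4 * (- 1) ^ j :]"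

lemma poly_limit_node:
  "poly (limit_node \<rho>1 j) y =
    leading j (2 * \<rho>1 + 1/2 - 2 * y + real j) * leading (j + 1) (2 * \<rho>1 + 1/2 + 2 * y + real j)"
  by (simp add: limit_node_def leading_def algebra_simps)

text \<open>
  The limit as a polynomial in Newton form; for each \<open>j\<close> only one of the factors with \<open>a z\<close> and
  \<open>a z\<inverse>\<close> vanishes at \<open>\<epsilon> = 0\<close>, so each node contributes a linear factor in \<open>y\<close>.
\<close>

definition bi_limit :: "real \<Rightarrow> real \<Rightarrow> real \<Rightarrow> real \<Rightarrow> nat \<Rightarrow> real poly" where
  "bi_limit r1 r2 \<rho>1 \<rho>2 n =
    (\<Sum>k\<le>n. \<Prod>j<k. smult (limit_ratio r1 r2 \<rho>1 \<rho>2 n j) (limit_node \<rho>1 j))"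

definition bi_defined :: "real \<Rightarrow> real \<Rightarrow> real \<Rightarrow> real \<Rightarrow> nat \<Rightarrow> real \<Rightarrow> bool" where
  "bi_defined r1 r2 \<rho>1 \<rho>2 n \<epsilon> \<longleftrightarrow>
    askey_wilson_defined n (bi_ab \<rho>1 \<epsilon>) (bi_ab \<rho>2 \<epsilon>) (bi_cd r2 \<epsilon>) (bi_cd r1 \<epsilon>) (bi_q \<epsilon>)"

lemma leading_denominators_nonzero:
  assumes "bi_defined r1 r2 \<rho>1 \<rho>2 n \<epsilon>" "j < n"
  shows "leading (j + 1) (2 * \<rho>1 + 2 * \<rho>2 + real j + 1) \<noteq> 0"
    "leading j (2 * \<rho>1 - 2 * r2 + real j + 1) \<noteq> 0"
    "leading j (2 * \<rho>1 - 2 * r1 + real j + 1) \<noteq> 0"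
    "leading (j + 1) (real j + 1) \<noteq> 0"
proof -
  let ?q = "bi_q \<epsilon>" and ?a = "bi_ab \<rho>1 \<epsilon>"
  have "qpoch (?a * bi_ab \<rho>2 \<epsilon>) ?q (Suc j) \<noteq> 0" "qpoch (?a * bi_cd r2 \<epsilon>) ?q (Suc j) \<noteq> 0"
      "qpoch (?a * bi_cd r1 \<epsilon>) ?q (Suc j) \<noteq> 0" "qpoch ?q ?q (Suc j) \<noteq> 0"
    using assms by (auto simp: askey_wilson_defined_def bi_defined_def)
  then have "1 - ?a * bi_ab \<rho>2 \<epsilon> * ?q ^ j \<noteq> 0" "1 - ?a * bi_cd r2 \<epsilon> * ?q ^ j \<noteq> 0"
      "1 - ?a * bi_cd r1 \<epsilon> * ?q ^ j \<noteq> 0" "1 - ?q * ?q ^ j \<noteq> 0"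
    by (simp_all add: qpoch_Suc)
  then have "1 - sexp \<epsilon> (j + 1) (2 * \<rho>1 + 2 * \<rho>2 + real j + 1) \<noteq> 0"
      "1 - sexp \<epsilon> j (2 * \<rho>1 - 2 * r2 + real j + 1) \<noteq> 0"
      "1 - sexp \<epsilon> j (2 * \<rho>1 - 2 * r1 + real j + 1) \<noteq> 0"
      "1 - sexp \<epsilon> (j + 1) (real j + 1) \<noteq> 0"
    unfolding bi_products bi_q_powers unfolding bi_q_sexp sexp_mult by (simp_all add: add_ac)
  from this[THEN leading_nonzero] show "leading (j + 1) (2 * \<rho>1 + 2 * \<rho>2 + real j + 1) \<noteq> 0"
    "leading j (2 * \<rho>1 - 2 * r2 + real j + 1) \<noteq> 0"
    "leading j (2 * \<rho>1 - 2 * r1 + real j + 1) \<noteq> 0"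
    "leading (j + 1) (real j + 1) \<noteq> 0"
    by blast+
qed

text \<open>
  Of the pairs \<open>q\<^sup>-\<^sup>n, abcdq\<^sup>n\<^sup>-\<^sup>1\<close> and \<open>a z, a z\<inverse>\<close> in the numerator, and \<open>ab, ac\<close> and \<open>ad, q\<close> in the
  denominator, each has for every \<open>j\<close> one member whose factor is of order \<open>\<epsilon>\<close> and one whose factor
  tends to \<open>2\<close>. The powers of \<open>\<epsilon>\<close> therefore cancel, and the quotient of the leading coefficients is the limit.
\<close>

lemma bi_factor_limit:
  assumes "bi_defined r1 r2 \<rho>1 \<rho>2 n \<epsilon>0" "j < n"
  shows "((\<lambda>\<epsilon>. aw_ratio n (bi_ab \<rho>1 \<epsilon>) (bi_ab \<rho>2 \<epsilon>) (bi_cd r2 \<epsilon>) (bi_cd r1 \<epsilon>) (bi_q \<epsilon>) j *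
      ((1 - bi_ab \<rho>1 \<epsilon> * bi_z \<epsilon> y * bi_q \<epsilon> ^ j) * (1 - bi_ab \<rho>1 \<epsilon> * inverse (bi_z \<epsilon> y) * bi_q \<epsilon> ^ j)))
    \<longlongrightarrow> of_real (poly (smult (limit_ratio r1 r2 \<rho>1 \<rho>2 n j) (limit_node \<rho>1 j)) y)) (at 0)"
proof -
  note nz = leading_denominators_nonzero[OF assms]
  let ?w = vanishing_order_weight
  define N1 where "N1 \<epsilon> = 1 - sexp \<epsilon> (n + j) (real j - real n)" for \<epsilon>
  define N2 where "N2 \<epsilon> = 1 - sexp \<epsilon> (n + j + 1) (2 * (\<rho>1 + \<rho>2 - r1 - r2) + real n + real j + 1)" for \<epsilon>
  define N3 where "N3 \<epsilon> = 1 - sexp \<epsilon> j (2 * \<rho>1 + 1/2 - 2 * y + real j)" for \<epsilon>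
  define N4 where "N4 \<epsilon> = 1 - sexp \<epsilon> (j + 1) (2 * \<rho>1 + 1/2 + 2 * y + real j)" for \<epsilon>
  define D1 where "D1 \<epsilon> = 1 - sexp \<epsilon> (j + 1) (2 * \<rho>1 + 2 * \<rho>2 + real j + 1)" for \<epsilon>
  define D2 where "D2 \<epsilon> = 1 - sexp \<epsilon> j (2 * \<rho>1 - 2 * r2 + real j + 1)" for \<epsilon>
  define D3 where "D3 \<epsilon> = 1 - sexp \<epsilon> j (2 * \<rho>1 - 2 * r1 + real j + 1)" for \<epsilon>
  define D4 where "D4 \<epsilon> = 1 - sexp \<epsilon> (j + 1) (real j + 1)" for \<epsilon>
  note defs = N1_def N2_def N3_def N4_def D1_def D2_def D3_def D4_def
  have eq: "aw_ratio n (bi_ab \<rho>1 \<epsilon>) (bi_ab \<rho>2 \<epsilon>) (bi_cd r2 \<epsilon>) (bi_cd r1 \<epsilon>) (bi_q \<epsilon>) j *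
      ((1 - bi_ab \<rho>1 \<epsilon> * bi_z \<epsilon> y * bi_q \<epsilon> ^ j) * (1 - bi_ab \<rho>1 \<epsilon> * inverse (bi_z \<epsilon> y) * bi_q \<epsilon> ^ j)) =
      N1 \<epsilon> * N2 \<epsilon> * sexp \<epsilon> 1 1 / (D1 \<epsilon> * D2 \<epsilon> * D3 \<epsilon> * D4 \<epsilon>) * (N3 \<epsilon> * N4 \<epsilon>)" for \<epsilon>
    unfolding bi_ratio_sexp bi_products bi_q_powers sexp_mult defs by (simp add: add_ac)
  have weights: "N1 \<epsilon> * N2 \<epsilon> * sexp \<epsilon> 1 1 / (D1 \<epsilon> * D2 \<epsilon> * D3 \<epsilon> * D4 \<epsilon>) * (N3 \<epsilon> * N4 \<epsilon>) =
      (N1 \<epsilon> / ?w \<epsilon> (n + j)) * (N2 \<epsilon> / ?w \<epsilon> (n + j + 1)) * sexp \<epsilon> 1 1 /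
      ((D1 \<epsilon> / ?w \<epsilon> (j + 1)) * (D2 \<epsilon> / ?w \<epsilon> j) * (D3 \<epsilon> / ?w \<epsilon> j) * (D4 \<epsilon> / ?w \<epsilon> (j + 1))) *
      ((N3 \<epsilon> / ?w \<epsilon> j) * (N4 \<epsilon> / ?w \<epsilon> (j + 1)))" if "\<epsilon> \<noteq> 0" for \<epsilon>
    using that by (cases "even n"; cases "even j") (simp_all add: vanishing_order_weight_def mult_ac)
  have "((\<lambda>\<epsilon>. (N1 \<epsilon> / ?w \<epsilon> (n + j)) * (N2 \<epsilon> / ?w \<epsilon> (n + j + 1)) * sexp \<epsilon> 1 1 /
      ((D1 \<epsilon> / ?w \<epsilon> (j + 1)) * (D2 \<epsilon> / ?w \<epsilon> j) * (D3 \<epsilon> / ?w \<epsilon> j) * (D4 \<epsilon> / ?w \<epsilon> (j + 1))) *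
      ((N3 \<epsilon> / ?w \<epsilon> j) * (N4 \<epsilon> / ?w \<epsilon> (j + 1)))) \<longlongrightarrow>
      of_real (leading (n + j) (real j - real n)) *
      of_real (leading (n + j + 1) (2 * (\<rho>1 + \<rho>2 - r1 - r2) + real n + real j + 1)) * (- 1) ^ 1 /
      (of_real (leading (j + 1) (2 * \<rho>1 + 2 * \<rho>2 + real j + 1)) *
       of_real (leading j (2 * \<rho>1 - 2 * r2 + real j + 1)) *
       of_real (leading j (2 * \<rho>1 - 2 * r1 + real j + 1)) * of_real (leading (j + 1) (real j + 1))) *
      (of_real (leading j (2 * \<rho>1 + 1/2 - 2 * y + real j)) *
       of_real (leading (j + 1) (2 * \<rho>1 + 1/2 + 2 * y + real j)))) (at 0)"
    unfolding defs using nz by (intro tendsto_mult tendsto_divide sexp_factor_limit sexp_limit) auto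
  also have "of_real (leading (n + j) (real j - real n)) *
      of_real (leading (n + j + 1) (2 * (\<rho>1 + \<rho>2 - r1 - r2) + real n + real j + 1)) * (- 1) ^ 1 /
      (of_real (leading (j + 1) (2 * \<rho>1 + 2 * \<rho>2 + real j + 1)) *
       of_real (leading j (2 * \<rho>1 - 2 * r2 + real j + 1)) *
       of_real (leading j (2 * \<rho>1 - 2 * r1 + real j + 1)) * of_real (leading (j + 1) (real j + 1))) *
      (of_real (leading j (2 * \<rho>1 + 1/2 - 2 * y + real j)) *
       of_real (leading (j + 1) (2 * \<rho>1 + 1/2 + 2 * y + real j))) =
      (of_real (poly (smult (limit_ratio r1 r2 \<rho>1 \<rho>2 n j) (limit_node \<rho>1 j)) y) :: complex)"
    unfolding poly_smult poly_limit_node limit_ratio_def by simp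
  finally show ?thesis
    unfolding eq
  proof (rule Lim_transform_eventually)
    show "\<forall>\<^sub>F \<epsilon> in at 0.
      (N1 \<epsilon> / ?w \<epsilon> (n + j)) * (N2 \<epsilon> / ?w \<epsilon> (n + j + 1)) * sexp \<epsilon> 1 1 /
      ((D1 \<epsilon> / ?w \<epsilon> (j + 1)) * (D2 \<epsilon> / ?w \<epsilon> j) * (D3 \<epsilon> / ?w \<epsilon> j) * (D4 \<epsilon> / ?w \<epsilon> (j + 1))) *
      ((N3 \<epsilon> / ?w \<epsilon> j) * (N4 \<epsilon> / ?w \<epsilon> (j + 1))) =
      N1 \<epsilon> * N2 \<epsilon> * sexp \<epsilon> 1 1 / (D1 \<epsilon> * D2 \<epsilon> * D3 \<epsilon> * D4 \<epsilon>) * (N3 \<epsilon> * N4 \<epsilon>)"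
      by (rule eventually_mono[OF eventually_neq_at_within]) (rule weights[symmetric])
  qed
qed

lemma bi_polynomial_limit:
  assumes "\<forall>\<^sub>F \<epsilon> in at 0. bi_defined r1 r2 \<rho>1 \<rho>2 n \<epsilon>"
  shows "((\<lambda>\<epsilon>. poly (askey_wilson n (bi_ab \<rho>1 \<epsilon>) (bi_ab \<rho>2 \<epsilon>) (bi_cd r2 \<epsilon>) (bi_cd r1 \<epsilon>) (bi_q \<epsilon>))
      (xz (bi_z \<epsilon> y))) \<longlongrightarrow> of_real (poly (bi_limit r1 r2 \<rho>1 \<rho>2 n) y)) (at 0)"
proof -
  obtain \<epsilon>0 where def: "bi_defined r1 r2 \<rho>1 \<rho>2 n \<epsilon>0"
    using eventually_happens[OF assms] by auto
  have expand: "poly (askey_wilson n (bi_ab \<rho>1 \<epsilon>) (bi_ab \<rho>2 \<epsilon>) (bi_cd r2 \<epsilon>) (bi_cd r1 \<epsilon>) (bi_q \<epsilon>))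
      (xz (bi_z \<epsilon> y)) =
    (\<Sum>k\<le>n. \<Prod>j<k. aw_ratio n (bi_ab \<rho>1 \<epsilon>) (bi_ab \<rho>2 \<epsilon>) (bi_cd r2 \<epsilon>) (bi_cd r1 \<epsilon>) (bi_q \<epsilon>) j *
      ((1 - bi_ab \<rho>1 \<epsilon> * bi_z \<epsilon> y * bi_q \<epsilon> ^ j) * (1 - bi_ab \<rho>1 \<epsilon> * inverse (bi_z \<epsilon> y) * bi_q \<epsilon> ^ j)))" for \<epsilon>
    using bi_z_nonzero sexp_nonzero[of \<epsilon> 1 1]
    by (subst poly_askey_wilson_basis) (auto simp: aw_basis_def qpoch_def prod.distrib bi_q_sexp)
  show ?thesis
    unfolding expand bi_limit_def poly_sum poly_prod of_real_sum of_real_prod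
    by (intro tendsto_sum tendsto_prod bi_factor_limit[OF def]) auto
qed

text \<open>
  For \<open>j < n\<close> the only factor that could vanish is the one from \<open>abcdq\<^sup>n\<^sup>-\<^sup>1\<close> with \<open>n + j + 1 = 2 k\<close>; it is a
  multiple of \<open>\<rho>1 + \<rho>2 - r1 - r2 + k\<close>, which the nondegeneracy condition keeps away from \<open>0\<close>.
\<close>

lemma limit_ratio_nonzero:
  assumes "bi_defined r1 r2 \<rho>1 \<rho>2 n \<epsilon>" "j < n"
    and nondeg: "\<And>k::nat. k \<ge> 1 \<Longrightarrow> \<rho>1 + \<rho>2 - r1 - r2 \<noteq> - real k"
  shows "limit_ratio r1 r2 \<rho>1 \<rho>2 n j \<noteq> 0"
proof -
  have "2 * (\<rho>1 + \<rho>2 - r1 - r2) + real n + real j + 1 \<noteq> 0" if "even (n + j + 1)"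
  proof -
    obtain k where k: "n + j + 1 = 2 * k" using \<open>even (n + j + 1)\<close> by (rule evenE)
    then have "k \<ge> 1" and "real n + real j + 1 = 2 * real k" by linarith+
    then have "2 * (\<rho>1 + \<rho>2 - r1 - r2) + real n + real j + 1 = 2 * (\<rho>1 + \<rho>2 - r1 - r2 + real k)"
      by simp
    moreover have "\<rho>1 + \<rho>2 - r1 - r2 + real k \<noteq> 0"
      using nondeg[OF \<open>k \<ge> 1\<close>] by (metis eq_neg_iff_add_eq_0)
    ultimately show ?thesis by simp
  qed
  then have "leading (n + j + 1) (2 * (\<rho>1 + \<rho>2 - r1 - r2) + real n + real j + 1) \<noteq> 0"
    by (auto simp: leading_def)
  moreover have "leading (n + j) (real j - real n) \<noteq> 0"
    using assms by (auto simp: leading_def)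
  ultimately show ?thesis
    unfolding limit_ratio_def using leading_denominators_nonzero[OF assms(1,2)] by simp
qed

lemma degree_sum_triangular:
  assumes "\<And>k. k \<le> n \<Longrightarrow> degree (e k) = k"
  shows "degree (\<Sum>k\<le>n. e k) = n"
proof (cases n)
  case (Suc m)
  have "degree (\<Sum>k\<le>m. e k) \<le> m"
    using assms Suc by (intro degree_sum_le) auto
  then have "degree ((\<Sum>k\<le>m. e k) + e (Suc m)) = degree (e (Suc m))"
    using assms[of "Suc m"] Suc by (intro degree_add_eq_right) auto
  then show ?thesis using Suc assms[of "Suc m"] by simp
qed (use assms in auto)

lemma degree_bi_limit:
  assumes "bi_defined r1 r2 \<rho>1 \<rho>2 n \<epsilon>"
    and nondeg: "\<And>k::nat. k \<ge> 1 \<Longrightarrow> \<rho>1 + \<rho>2 - r1 - r2 \<noteq> - real k"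
  shows "degree (bi_limit r1 r2 \<rho>1 \<rho>2 n) = n"
  unfolding bi_limit_def
proof (rule degree_sum_triangular)
  fix k assume "k \<le> n"
  have nz: "limit_ratio r1 r2 \<rho>1 \<rho>2 n j \<noteq> 0" if "j < k" for j
    using limit_ratio_nonzero[OF assms(1) _ nondeg] that \<open>k \<le> n\<close> by auto
  then have "degree (\<Prod>j<k. smult (limit_ratio r1 r2 \<rho>1 \<rho>2 n j) (limit_node \<rho>1 j)) =
      (\<Sum>j<k. degree (smult (limit_ratio r1 r2 \<rho>1 \<rho>2 n j) (limit_node \<rho>1 j)))"
    by (intro degree_prod_eq_sum_degree) (auto simp: limit_node_def)
  also have "\<dots> = (\<Sum>j<k. 1)"
    using nz by (intro sum.cong) (auto simp: limit_node_def)
  finally show "degree (\<Prod>j<k. smult (limit_ratio r1 r2 \<rho>1 \<rho>2 n j) (limit_node \<rho>1 j)) = k"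
    by simp
qed

lemma bi_limit_nonzero:
  assumes "bi_defined r1 r2 \<rho>1 \<rho>2 n \<epsilon>"
    and nondeg: "\<And>k::nat. k \<ge> 1 \<Longrightarrow> \<rho>1 + \<rho>2 - r1 - r2 \<noteq> - real k"
  shows "bi_limit r1 r2 \<rho>1 \<rho>2 n \<noteq> 0"
proof (cases "n = 0")
  case True
  then show ?thesis by (simp add: bi_limit_def)
next
  case False
  then show ?thesis using degree_bi_limit[OF assms] by auto
qed

section \<open>Limits of the coefficients and of the eigenvalue\<close>

text \<open>
  In \<open>\<Omega>(z)\<close> the factors of \<open>a\<close> and \<open>b\<close> vanish at \<open>\<epsilon> = 0\<close>, in \<open>\<Omega>(z\<inverse>)\<close> those of \<open>c\<close> and \<open>d\<close>. The
  parity \<open>m\<close> covers both cases: there are always two vanishing factors above, matched by two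
  below, the second one in the denominator of \<open>\<Omega>\<close> and \<open>1 + q\<close>.
\<close>

lemma aw_Omega_limit:
  assumes "\<And>\<epsilon>. a \<epsilon> * z \<epsilon> = sexp \<epsilon> m x1" "\<And>\<epsilon>. b \<epsilon> * z \<epsilon> = sexp \<epsilon> m x2"
    and "\<And>\<epsilon>. c \<epsilon> * z \<epsilon> = sexp \<epsilon> (m + 1) x3" "\<And>\<epsilon>. d \<epsilon> * z \<epsilon> = sexp \<epsilon> (m + 1) x4"
    and "\<And>\<epsilon>. (z \<epsilon>)\<^sup>2 = sexp \<epsilon> 1 t" "1 + t \<noteq> 0"
  shows "((\<lambda>\<epsilon>. aw_Omega (a \<epsilon>) (b \<epsilon>) (c \<epsilon>) (d \<epsilon>) (bi_q \<epsilon>) (z \<epsilon>) / (4 * (1 + bi_q \<epsilon>))) \<longlongrightarrow>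
    of_real (leading m x1 * leading m x2 * leading (m + 1) x3 * leading (m + 1) x4 / (8 * (1 + t)))) (at 0)"
proof -
  let ?F = "\<lambda>\<epsilon> m x. (1 - sexp \<epsilon> m x) / vanishing_order_weight \<epsilon> m"
  have nz: "of_real (leading 1 t) * of_real (leading 0 (1 + t)) \<noteq> (0 :: complex)"
      "4 * of_real (leading 0 1) \<noteq> (0 :: complex)"
    unfolding mult_eq_0_iff of_real_eq_0_iff using assms(6) by (auto simp: leading_def)
  have "((\<lambda>\<epsilon>. ?F \<epsilon> m x1 * ?F \<epsilon> m x2 * ?F \<epsilon> (m + 1) x3 * ?F \<epsilon> (m + 1) x4 /
        (?F \<epsilon> 1 t * ?F \<epsilon> 0 (1 + t)) / (4 * ?F \<epsilon> 0 1)) \<longlongrightarrow>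
      of_real (leading m x1) * of_real (leading m x2) *
        of_real (leading (m + 1) x3) * of_real (leading (m + 1) x4) /
        (of_real (leading 1 t) * of_real (leading 0 (1 + t))) / (4 * of_real (leading 0 1))) (at 0)"
    by (intro tendsto_mult tendsto_divide tendsto_const sexp_factor_limit nz)
  also have "of_real (leading m x1) * of_real (leading m x2) *
        of_real (leading (m + 1) x3) * of_real (leading (m + 1) x4) /
        (of_real (leading 1 t) * of_real (leading 0 (1 + t))) / (4 * of_real (leading 0 1)) =
      (of_real (leading m x1 * leading m x2 * leading (m + 1) x3 * leading (m + 1) x4 /
        (leading 1 t * leading 0 (1 + t)) / (4 * leading 0 1)) :: complex)"
    by simp
  also have "(leading 1 t * leading 0 (1 + t)) * (4 * leading 0 1) = 8 * (1 + t)"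
    by (simp add: leading_def)
  then have "leading m x1 * leading m x2 * leading (m + 1) x3 * leading (m + 1) x4 /
        (leading 1 t * leading 0 (1 + t)) / (4 * leading 0 1) =
      leading m x1 * leading m x2 * leading (m + 1) x3 * leading (m + 1) x4 / (8 * (1 + t))"
    by (simp only: divide_divide_eq_left)
  finally show ?thesis
  proof (rule Lim_transform_eventually)
    have "?F \<epsilon> m x1 * ?F \<epsilon> m x2 * ?F \<epsilon> (m + 1) x3 * ?F \<epsilon> (m + 1) x4 /
        (?F \<epsilon> 1 t * ?F \<epsilon> 0 (1 + t)) / (4 * ?F \<epsilon> 0 1) =
      aw_Omega (a \<epsilon>) (b \<epsilon>) (c \<epsilon>) (d \<epsilon>) (bi_q \<epsilon>) (z \<epsilon>) / (4 * (1 + bi_q \<epsilon>))" if "\<epsilon> \<noteq> 0" for \<epsilon>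
    proof -
      have "bi_q \<epsilon> * (z \<epsilon>)\<^sup>2 = sexp \<epsilon> 0 (1 + t)"
        unfolding assms(5) bi_q_sexp sexp_mult by (rule sexp_cong) simp
      then show ?thesis
        using that unfolding aw_Omega_def one_plus_bi_q assms(1-5)
        by (cases "even m") (simp_all add: vanishing_order_weight_def)
    qed
    then show "\<forall>\<^sub>F \<epsilon> in at 0. ?F \<epsilon> m x1 * ?F \<epsilon> m x2 * ?F \<epsilon> (m + 1) x3 * ?F \<epsilon> (m + 1) x4 /
        (?F \<epsilon> 1 t * ?F \<epsilon> 0 (1 + t)) / (4 * ?F \<epsilon> 0 1) =
      aw_Omega (a \<epsilon>) (b \<epsilon>) (c \<epsilon>) (d \<epsilon>) (bi_q \<epsilon>) (z \<epsilon>) / (4 * (1 + bi_q \<epsilon>))"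
      by (simp add: eventually_at_filter)
  qed
qed

lemma bi_Omega_limit:
  assumes "y \<noteq> 1/4"
  shows "((\<lambda>\<epsilon>. aw_Omega (bi_ab \<rho>1 \<epsilon>) (bi_ab \<rho>2 \<epsilon>) (bi_cd r2 \<epsilon>) (bi_cd r1 \<epsilon>) (bi_q \<epsilon>) (bi_z \<epsilon> y) /
      (4 * (1 + bi_q \<epsilon>))) \<longlongrightarrow> of_real (bi_Phi1 \<rho>1 \<rho>2 y)) (at 0)"
proof -
  have "1 + (- 4 * y) \<noteq> 0" using assms by auto
  note lim = aw_Omega_limit[where z = "\<lambda>\<epsilon>. bi_z \<epsilon> y" and m = 0, unfolded add_0,
      OF bi_products(4) bi_products(4) bi_products(6) bi_products(6) bi_products(8) this,
      of \<rho>1 \<rho>2 r2 r1]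
  have "leading 0 (2 * \<rho>1 + 1/2 - 2 * y) * leading 0 (2 * \<rho>2 + 1/2 - 2 * y) *
        leading 1 (1/2 - 2 * r2 - 2 * y) * leading 1 (1/2 - 2 * r1 - 2 * y) / (8 * (1 + (- 4 * y))) =
      bi_Phi1 \<rho>1 \<rho>2 y"
    using assms by (simp add: leading_def bi_Phi1_def divide_simps) (simp add: algebra_simps)
  with lim show ?thesis by (simp only:)
qed

lemma bi_Omega_inverse_limit:
  assumes "y \<noteq> - 1/4"
  shows "((\<lambda>\<epsilon>. aw_Omega (bi_ab \<rho>1 \<epsilon>) (bi_ab \<rho>2 \<epsilon>) (bi_cd r2 \<epsilon>) (bi_cd r1 \<epsilon>) (bi_q \<epsilon>)
      (inverse (bi_z \<epsilon> y)) / (4 * (1 + bi_q \<epsilon>))) \<longlongrightarrow> of_real (bi_Phi2 r1 r2 y)) (at 0)"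
proof -
  have nz: "1 + 4 * y \<noteq> 0" using assms by auto
  have cd: "bi_cd r \<epsilon> * inverse (bi_z \<epsilon> y) = sexp \<epsilon> (1 + 1) (1/2 - 2 * r + 2 * y)" for r \<epsilon>
    unfolding bi_products by (rule sexp_cong) simp
  note lim = aw_Omega_limit[where z = "\<lambda>\<epsilon>. inverse (bi_z \<epsilon> y)" and m = 1,
      OF bi_products(5) bi_products(5) cd cd bi_products(9) nz, of \<rho>1 \<rho>2 r2 r1]
  have "leading 1 (2 * \<rho>1 + 1/2 + 2 * y) * leading 1 (2 * \<rho>2 + 1/2 + 2 * y) *
        leading (1 + 1) (1/2 - 2 * r2 + 2 * y) * leading (1 + 1) (1/2 - 2 * r1 + 2 * y) / (8 * (1 + 4 * y)) =
      bi_Phi2 r1 r2 y"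
    using nz by (simp add: leading_def bi_Phi2_def divide_simps) (simp add: algebra_simps)
  with lim show ?thesis by (simp only:)
qed

lemma bi_Lambda_limit:
  "((\<lambda>\<epsilon>. aw_Lambda n (bi_ab \<rho>1 \<epsilon>) (bi_ab \<rho>2 \<epsilon>) (bi_cd r2 \<epsilon>) (bi_cd r1 \<epsilon>) (bi_q \<epsilon>) /
      (4 * (1 + bi_q \<epsilon>))) \<longlongrightarrow> of_real (bi_lambda r1 r2 \<rho>1 \<rho>2 n)) (at 0)"
proof -
  let ?F = "\<lambda>\<epsilon> m x. (1 - sexp \<epsilon> m x) / vanishing_order_weight \<epsilon> m"
  let ?x = "2 * (\<rho>1 + \<rho>2 - r1 - r2) + 2 + (real n - 1)"
  have "((\<lambda>\<epsilon>. - ?F \<epsilon> n (- real n) * ?F \<epsilon> (n + 1) ?x / (4 * ?F \<epsilon> 0 1)) \<longlongrightarrow>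
      - of_real (leading n (- real n)) * of_real (leading (n + 1) ?x) / (4 * of_real (leading 0 1))) (at 0)"
    by (intro tendsto_mult tendsto_divide tendsto_minus tendsto_const sexp_factor_limit) (auto simp: leading_def)
  also have "- of_real (leading n (- real n)) * of_real (leading (n + 1) ?x) / (4 * of_real (leading 0 1)) =
      (of_real (- leading n (- real n) * leading (n + 1) ?x / (4 * leading 0 1)) :: complex)"
    by simp
  also have "- leading n (- real n) * leading (n + 1) ?x / (4 * leading 0 1) = bi_lambda r1 r2 \<rho>1 \<rho>2 n"
    by (simp add: leading_def bi_lambda_def field_simps)
  finally show ?thesis
  proof (rule Lim_transform_eventually)
    have "aw_Lambda n (bi_ab \<rho>1 \<epsilon>) (bi_ab \<rho>2 \<epsilon>) (bi_cd r2 \<epsilon>) (bi_cd r1 \<epsilon>) (bi_q \<epsilon>) =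
        - ((1 - sexp \<epsilon> n (- real n)) * (1 - sexp \<epsilon> (n + 1) ?x))" for \<epsilon>
      unfolding aw_Lambda_def bi_abcd bi_q_powers sexp_mult add_0 by algebra
    then show "\<forall>\<^sub>F \<epsilon> in at 0. - ?F \<epsilon> n (- real n) * ?F \<epsilon> (n + 1) ?x / (4 * ?F \<epsilon> 0 1) =
      aw_Lambda n (bi_ab \<rho>1 \<epsilon>) (bi_ab \<rho>2 \<epsilon>) (bi_cd r2 \<epsilon>) (bi_cd r1 \<epsilon>) (bi_q \<epsilon>) / (4 * (1 + bi_q \<epsilon>))"
      unfolding eventually_at_filter one_plus_bi_q
      by (intro always_eventually allI impI) (simp only:, simp add: vanishing_order_weight_def)
  qed
qed

lemma bi_difference_equation:
  assumes "\<epsilon> \<noteq> 0" "y \<noteq> 1/4" "y \<noteq> - 1/4" "bi_defined r1 r2 \<rho>1 \<rho>2 n \<epsilon>"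
  defines "\<Omega> \<equiv> aw_Omega (bi_ab \<rho>1 \<epsilon>) (bi_ab \<rho>2 \<epsilon>) (bi_cd r2 \<epsilon>) (bi_cd r1 \<epsilon>) (bi_q \<epsilon>)"
    and "R \<equiv> \<lambda>w. poly (askey_wilson n (bi_ab \<rho>1 \<epsilon>) (bi_ab \<rho>2 \<epsilon>) (bi_cd r2 \<epsilon>) (bi_cd r1 \<epsilon>) (bi_q \<epsilon>)) (xz w)"
  shows "\<Omega> (bi_z \<epsilon> y) * R (bi_z \<epsilon> y * bi_q \<epsilon>) + \<Omega> (inverse (bi_z \<epsilon> y)) * R (bi_z \<epsilon> y * inverse (bi_q \<epsilon>))
      - (\<Omega> (bi_z \<epsilon> y) + \<Omega> (inverse (bi_z \<epsilon> y))) * R (bi_z \<epsilon> y) =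
    aw_Lambda n (bi_ab \<rho>1 \<epsilon>) (bi_ab \<rho>2 \<epsilon>) (bi_cd r2 \<epsilon>) (bi_cd r1 \<epsilon>) (bi_q \<epsilon>) * R (bi_z \<epsilon> y)"
  unfolding \<Omega>_def R_def
proof (rule askey_wilson_difference_equation)
  show "askey_wilson_defined n (bi_ab \<rho>1 \<epsilon>) (bi_ab \<rho>2 \<epsilon>) (bi_cd r2 \<epsilon>) (bi_cd r1 \<epsilon>) (bi_q \<epsilon>)"
    using assms(4) by (simp add: bi_defined_def)
  show "bi_z \<epsilon> y \<noteq> 0" by (rule bi_z_nonzero)
  show "(bi_z \<epsilon> y)\<^sup>2 \<noteq> 1" unfolding bi_products by (rule sexp_ne_1) (use assms in auto)
  show "bi_q \<epsilon> * (bi_z \<epsilon> y)\<^sup>2 \<noteq> 1"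
    unfolding bi_products bi_q_sexp sexp_mult by (rule sexp_ne_1) (use assms in auto)
  show "(bi_z \<epsilon> y)\<^sup>2 \<noteq> bi_q \<epsilon>"
  proof
    assume "(bi_z \<epsilon> y)\<^sup>2 = bi_q \<epsilon>"
    then have "bi_q \<epsilon> * inverse ((bi_z \<epsilon> y)\<^sup>2) = 1"
      using sexp_nonzero[of \<epsilon> 1 1] by (simp add: bi_q_sexp)
    moreover have "bi_q \<epsilon> * inverse ((bi_z \<epsilon> y)\<^sup>2) \<noteq> 1"
      unfolding bi_products bi_q_sexp sexp_inverse sexp_mult by (rule sexp_ne_1) (use assms in auto)
    ultimately show False by simp
  qed
qed

section \<open>Conjugation by translations\<close>

lemma Hop_conjugate:
  "Top h \<circ> Hop r1 r2 \<rho>1 \<rho>2 \<circ> Top (- h) =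
    (\<lambda>f y. of_real (bi_Phi1 \<rho>1 \<rho>2 (y + h)) * Top (2 * h - 1/2) (Rop f) y
         + of_real (bi_Phi2 r1 r2 (y + h)) * Top (2 * h + 1/2) (Rop f) y
         - of_real (bi_Phi1 \<rho>1 \<rho>2 (y + h)) * f y
         - of_real (bi_Phi2 r1 r2 (y + h)) * f y)"
  by (intro ext) (simp add: Hop_def Top_def Rop_def algebra_simps)

lemma bi_F_Phi1: "bi_F \<rho>1 \<rho>2 y = - bi_Phi1 \<rho>1 \<rho>2 (y + 1/4)"
  by (cases "y = 0") (simp_all add: bi_F_def bi_Phi1_def field_simps)

lemma bi_G_Phi2: "bi_G r1 r2 y = bi_Phi2 r1 r2 (y + 1/4)"
proof -
  have "2 * (y + 1/4 - r1 + 1/4) * (y + 1/4 - r2 + 1/4) / (4 * (y + 1/4) + 1) =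
      (2 * ((y - r1 + 1/2) * (y - r2 + 1/2))) / (2 * (2 * y + 1))"
    by (simp add: algebra_simps)
  then show ?thesis unfolding bi_G_def bi_Phi2_def by (simp only: mult_divide_mult_cancel_left_if) simp
qed

lemma Lop_conjugate: "Top (1/4) \<circ> Hop r1 r2 \<rho>1 \<rho>2 \<circ> Top (- (1/4)) = Lop r1 r2 \<rho>1 \<rho>2"
  unfolding Hop_conjugate
  by (intro ext) (simp add: Lop_def bi_F_Phi1 bi_G_Phi2 Top_def Rop_def algebra_simps)

lemma Hop_scale: "Hop r1 r2 \<rho>1 \<rho>2 (\<lambda>t. k * f t) y = k * Hop r1 r2 \<rho>1 \<rho>2 f y"
  by (simp add: Hop_def Top_def Rop_def algebra_simps)

text \<open>
  Translation by a quarter carries \<open>H\<close> to \<open>L\<close>, and the poles \<open>1/4\<close>, \<open>-1/4\<close> of the coefficients of \<open>H\<close>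
  to the poles \<open>0\<close>, \<open>-1/2\<close> of those of \<open>L\<close>; normalising the leading coefficient is harmless because
  the eigenvalue equation is linear.
\<close>

lemma monic_bannai_ito_shift:
  fixes p :: "real poly"
  assumes p: "p \<noteq> 0" "degree p = n"
    and eigen: "\<And>y. y \<noteq> 1/4 \<Longrightarrow> y \<noteq> - 1/4 \<Longrightarrow>
      Hop r1 r2 \<rho>1 \<rho>2 (\<lambda>t. of_real (poly p t)) y = of_real (bi_lambda r1 r2 \<rho>1 \<rho>2 n) * of_real (poly p y)"
  defines "P \<equiv> smult (inverse (lead_coeff p)) (pcompose p [:1/4, 1:])"
  shows "monic_bannai_ito r1 r2 \<rho>1 \<rho>2 n P" "poly p y = lead_coeff p * poly P (y - 1/4)"
proof -
  show "poly p y = lead_coeff p * poly P (y - 1/4)"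
    using leading_coeff_neq_0[OF p(1)] by (simp add: P_def poly_pcompose)
  have "Lop r1 r2 \<rho>1 \<rho>2 (\<lambda>t. of_real (poly P t)) y = of_real (bi_lambda r1 r2 \<rho>1 \<rho>2 n * poly P y)"
    if "y \<noteq> 0" "y \<noteq> - 1/2" for y
  proof -
    have "Top (- (1/4)) (\<lambda>t. complex_of_real (poly P t)) =
        (\<lambda>t. of_real (inverse (lead_coeff p)) * of_real (poly p t))"
      by (auto simp: Top_def P_def poly_pcompose)
    then have "Lop r1 r2 \<rho>1 \<rho>2 (\<lambda>t. of_real (poly P t)) y =
        Hop r1 r2 \<rho>1 \<rho>2 (\<lambda>t. of_real (inverse (lead_coeff p)) * of_real (poly p t)) (y + 1/4)"
      unfolding Lop_conjugate[symmetric] by (simp add: Top_def)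
    also have "\<dots> = of_real (inverse (lead_coeff p)) *
        (of_real (bi_lambda r1 r2 \<rho>1 \<rho>2 n) * of_real (poly p (y + 1/4)))"
      unfolding Hop_scale using that by (subst eigen) auto
    finally show ?thesis by (simp add: P_def poly_pcompose add.commute)
  qed
  moreover have "degree P = n" using p(1) by (simp add: P_def degree_pcompose p(2)[symmetric])
  moreover have "lead_coeff P = 1"
    unfolding P_def lead_coeff_smult
    using leading_coeff_neq_0[OF p(1)] by (subst lead_coeff_comp) auto
  ultimately show "monic_bannai_ito r1 r2 \<rho>1 \<rho>2 n P"
    by (simp add: monic_bannai_ito_def)
qed

section \<open>The limit from Askey-Wilson to Bannai-Ito\<close>

theorem mainTheorem15:
  fixes r1 r2 \<rho>1 \<rho>2 :: real
    and n :: nat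
    and q a b c d :: "real \<Rightarrow> complex"
    and z :: "real \<Rightarrow> real \<Rightarrow> complex"
    and Rn :: "real \<Rightarrow> complex \<Rightarrow> complex"
    and Rm1 :: "real \<Rightarrow> complex"
    and \<Omega> :: "real \<Rightarrow> complex \<Rightarrow> complex"
    and \<Lambda> :: "real \<Rightarrow> complex"
  assumes nondeg: "\<And>k::nat. k \<ge> 1 \<Longrightarrow> \<rho>1 + \<rho>2 - r1 - r2 \<noteq> - real k"
    and q: "\<And>\<epsilon>. q \<epsilon> = - exp (of_real \<epsilon>)"
    and a: "\<And>\<epsilon>. a \<epsilon> = - \<i> * exp (of_real (\<epsilon> * (2 * \<rho>1 + 1/2)))"
    and b: "\<And>\<epsilon>. b \<epsilon> = - \<i> * exp (of_real (\<epsilon> * (2 * \<rho>2 + 1/2)))"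
    and c: "\<And>\<epsilon>. c \<epsilon> = \<i> * exp (of_real (\<epsilon> * (- 2 * r2 + 1/2)))"
    and d: "\<And>\<epsilon>. d \<epsilon> = \<i> * exp (of_real (\<epsilon> * (- 2 * r1 + 1/2)))"
    and z: "\<And>\<epsilon> y. z \<epsilon> y = \<i> * exp (of_real (- 2 * \<epsilon> * y))"
    and defined: "\<forall>\<^sub>F \<epsilon> in at 0. askey_wilson_defined n (a \<epsilon>) (b \<epsilon>) (c \<epsilon>) (d \<epsilon>) (q \<epsilon>)"
    and Rn: "\<And>\<epsilon> x. Rn \<epsilon> x = poly (askey_wilson n (a \<epsilon>) (b \<epsilon>) (c \<epsilon>) (d \<epsilon>) (q \<epsilon>)) x"
    and Rm1: "\<And>y. Rm1 y = Lim (at 0) (\<lambda>\<epsilon>. Rn \<epsilon> (xz (z \<epsilon> y)))"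
    and \<Omega>: "\<And>\<epsilon> w. \<Omega> \<epsilon> w = aw_Omega (a \<epsilon>) (b \<epsilon>) (c \<epsilon>) (d \<epsilon>) (q \<epsilon>) w"
    and \<Lambda>: "\<And>\<epsilon>. \<Lambda> \<epsilon> = aw_Lambda n (a \<epsilon>) (b \<epsilon>) (c \<epsilon>) (d \<epsilon>) (q \<epsilon>)"
  shows
    "(\<forall>y. ((\<lambda>\<epsilon>. Rn \<epsilon> (xz (z \<epsilon> y))) \<longlongrightarrow> Rm1 y) (at 0))
   \<and> (\<exists>p :: real poly. degree p = n \<and> (\<forall>y. Rm1 y = of_real (poly p y)) \<and>
        (\<exists>P. monic_bannai_ito r1 r2 \<rho>1 \<rho>2 n P \<and>
             (\<forall>y. poly p y = lead_coeff p * poly P (y - 1/4))))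
   \<and> (\<forall>y. ((\<lambda>\<epsilon>. Rn \<epsilon> (xz (z \<epsilon> y * q \<epsilon>))) \<longlongrightarrow> Rm1 (- y + 1/2)) (at 0))
   \<and> (\<forall>y. ((\<lambda>\<epsilon>. Rn \<epsilon> (xz (z \<epsilon> y * inverse (q \<epsilon>)))) \<longlongrightarrow> Rm1 (- y - 1/2)) (at 0))
   \<and> (\<forall>y. y \<noteq> 1/4 \<longrightarrow>
        ((\<lambda>\<epsilon>. \<Omega> \<epsilon> (z \<epsilon> y) / (4 * (1 + q \<epsilon>))) \<longlongrightarrow> of_real (bi_Phi1 \<rho>1 \<rho>2 y)) (at 0))
   \<and> (\<forall>y. y \<noteq> - 1/4 \<longrightarrow>
        ((\<lambda>\<epsilon>. \<Omega> \<epsilon> (inverse (z \<epsilon> y)) / (4 * (1 + q \<epsilon>))) \<longlongrightarrow> of_real (bi_Phi2 r1 r2 y)) (at 0))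
   \<and> ((\<lambda>\<epsilon>. \<Lambda> \<epsilon> / (4 * (1 + q \<epsilon>))) \<longlongrightarrow> of_real (bi_lambda r1 r2 \<rho>1 \<rho>2 n)) (at 0)
   \<and> (\<forall>y. y \<noteq> 1/4 \<and> y \<noteq> - 1/4 \<longrightarrow>
        (\<forall>\<^sub>F \<epsilon> in at 0.
            \<Omega> \<epsilon> (z \<epsilon> y) * Rn \<epsilon> (xz (z \<epsilon> y * q \<epsilon>))
          + \<Omega> \<epsilon> (inverse (z \<epsilon> y)) * Rn \<epsilon> (xz (z \<epsilon> y * inverse (q \<epsilon>)))
          - (\<Omega> \<epsilon> (z \<epsilon> y) + \<Omega> \<epsilon> (inverse (z \<epsilon> y))) * Rn \<epsilon> (xz (z \<epsilon> y))
          = \<Lambda> \<epsilon> * Rn \<epsilon> (xz (z \<epsilon> y)))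
      \<and> ((\<lambda>\<epsilon>. (\<Omega> \<epsilon> (z \<epsilon> y) * Rn \<epsilon> (xz (z \<epsilon> y * q \<epsilon>))
          + \<Omega> \<epsilon> (inverse (z \<epsilon> y)) * Rn \<epsilon> (xz (z \<epsilon> y * inverse (q \<epsilon>)))
          - (\<Omega> \<epsilon> (z \<epsilon> y) + \<Omega> \<epsilon> (inverse (z \<epsilon> y))) * Rn \<epsilon> (xz (z \<epsilon> y))) / (4 * (1 + q \<epsilon>)))
          \<longlongrightarrow> of_real (bi_Phi1 \<rho>1 \<rho>2 y) * Rm1 (- y + 1/2)
            + of_real (bi_Phi2 r1 r2 y) * Rm1 (- y - 1/2)
            - of_real (bi_Phi1 \<rho>1 \<rho>2 y + bi_Phi2 r1 r2 y) * Rm1 y) (at 0)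
      \<and> ((\<lambda>\<epsilon>. \<Lambda> \<epsilon> * Rn \<epsilon> (xz (z \<epsilon> y)) / (4 * (1 + q \<epsilon>)))
          \<longlongrightarrow> of_real (bi_lambda r1 r2 \<rho>1 \<rho>2 n) * Rm1 y) (at 0)
      \<and> of_real (bi_Phi1 \<rho>1 \<rho>2 y) * Rm1 (- y + 1/2)
            + of_real (bi_Phi2 r1 r2 y) * Rm1 (- y - 1/2)
            - of_real (bi_Phi1 \<rho>1 \<rho>2 y + bi_Phi2 r1 r2 y) * Rm1 y
          = of_real (bi_lambda r1 r2 \<rho>1 \<rho>2 n) * Rm1 y
      \<and> Hop r1 r2 \<rho>1 \<rho>2 Rm1 y = of_real (bi_lambda r1 r2 \<rho>1 \<rho>2 n) * Rm1 y)
   \<and> (\<forall>h. Top h \<circ> Hop r1 r2 \<rho>1 \<rho>2 \<circ> Top (- h) =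
        (\<lambda>f y. of_real (bi_Phi1 \<rho>1 \<rho>2 (y + h)) * Top (2 * h - 1/2) (Rop f) y
             + of_real (bi_Phi2 r1 r2 (y + h)) * Top (2 * h + 1/2) (Rop f) y
             - of_real (bi_Phi1 \<rho>1 \<rho>2 (y + h)) * f y
             - of_real (bi_Phi2 r1 r2 (y + h)) * f y))
   \<and> (\<forall>y. bi_F \<rho>1 \<rho>2 y = - bi_Phi1 \<rho>1 \<rho>2 (y + 1/4))
   \<and> (\<forall>y. bi_G r1 r2 y = bi_Phi2 r1 r2 (y + 1/4))
   \<and> Top (1/4) \<circ> Hop r1 r2 \<rho>1 \<rho>2 \<circ> Top (- (1/4)) = Lop r1 r2 \<rho>1 \<rho>2
   \<and> Top (- (1/4)) \<circ> Hop r1 r2 \<rho>1 \<rho>2 \<circ> Top (1/4) =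
        (\<lambda>f y. of_real (bi_Phi1 \<rho>1 \<rho>2 (y - 1/4)) * Top (- 1) (Rop f) y
             + of_real (bi_Phi2 r1 r2 (y - 1/4)) * Rop f y
             - of_real (bi_Phi1 \<rho>1 \<rho>2 (y - 1/4)) * f y
             - of_real (bi_Phi2 r1 r2 (y - 1/4)) * f y)"
proof -
  have params: "q = bi_q" "a = bi_ab \<rho>1" "b = bi_ab \<rho>2" "c = bi_cd r2" "d = bi_cd r1" "z = bi_z"
    by (auto simp: fun_eq_iff q a b c d z bi_q_def bi_ab_def bi_cd_def bi_z_def)
  have def: "\<forall>\<^sub>F \<epsilon> in at 0. bi_defined r1 r2 \<rho>1 \<rho>2 n \<epsilon>"
    using defined by (simp add: params bi_defined_def)
  then obtain \<epsilon>0 where def0: "bi_defined r1 r2 \<rho>1 \<rho>2 n \<epsilon>0"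
    using eventually_happens[OF def] by auto
  define p where "p = bi_limit r1 r2 \<rho>1 \<rho>2 n"
  have lim: "((\<lambda>\<epsilon>. Rn \<epsilon> (xz (z \<epsilon> y))) \<longlongrightarrow> of_real (poly p y)) (at 0)" for y
    unfolding Rn params p_def by (rule bi_polynomial_limit[OF def])
  then have Rm1_p: "Rm1 y = of_real (poly p y)" for y
    unfolding Rm1 by (intro tendsto_Lim) auto
  have R: "((\<lambda>\<epsilon>. Rn \<epsilon> (xz (z \<epsilon> y))) \<longlongrightarrow> Rm1 y) (at 0)" for y
    unfolding Rm1_p by (rule lim)
  have Rq: "((\<lambda>\<epsilon>. Rn \<epsilon> (xz (z \<epsilon> y * q \<epsilon>))) \<longlongrightarrow> Rm1 (- y + 1/2)) (at 0)" for y
    using R[of "- y + 1/2"] by (simp only: params bi_z_mult_q xz_inverse)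
  have Rq': "((\<lambda>\<epsilon>. Rn \<epsilon> (xz (z \<epsilon> y * inverse (q \<epsilon>)))) \<longlongrightarrow> Rm1 (- y - 1/2)) (at 0)" for y
    using R[of "- y - 1/2"] by (simp only: params bi_z_div_q xz_inverse)
  have O1: "((\<lambda>\<epsilon>. \<Omega> \<epsilon> (z \<epsilon> y) / (4 * (1 + q \<epsilon>))) \<longlongrightarrow> of_real (bi_Phi1 \<rho>1 \<rho>2 y)) (at 0)"
    if "y \<noteq> 1/4" for y
    unfolding \<Omega> params by (rule bi_Omega_limit[OF that])
  have O2: "((\<lambda>\<epsilon>. \<Omega> \<epsilon> (inverse (z \<epsilon> y)) / (4 * (1 + q \<epsilon>))) \<longlongrightarrow> of_real (bi_Phi2 r1 r2 y)) (at 0)"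
    if "y \<noteq> - 1/4" for y
    unfolding \<Omega> params by (rule bi_Omega_inverse_limit[OF that])
  have L: "((\<lambda>\<epsilon>. \<Lambda> \<epsilon> / (4 * (1 + q \<epsilon>))) \<longlongrightarrow> of_real (bi_lambda r1 r2 \<rho>1 \<rho>2 n)) (at 0)"
    unfolding \<Lambda> params by (rule bi_Lambda_limit)
  let ?lhs = "\<lambda>\<epsilon> y. \<Omega> \<epsilon> (z \<epsilon> y) * Rn \<epsilon> (xz (z \<epsilon> y * q \<epsilon>))
          + \<Omega> \<epsilon> (inverse (z \<epsilon> y)) * Rn \<epsilon> (xz (z \<epsilon> y * inverse (q \<epsilon>)))
          - (\<Omega> \<epsilon> (z \<epsilon> y) + \<Omega> \<epsilon> (inverse (z \<epsilon> y))) * Rn \<epsilon> (xz (z \<epsilon> y))"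
  let ?lim = "\<lambda>y. of_real (bi_Phi1 \<rho>1 \<rho>2 y) * Rm1 (- y + 1/2)
            + of_real (bi_Phi2 r1 r2 y) * Rm1 (- y - 1/2)
            - of_real (bi_Phi1 \<rho>1 \<rho>2 y + bi_Phi2 r1 r2 y) * Rm1 y"
  \<comment> \<open>Away from \<open>y = 1/4\<close> and \<open>y = -1/4\<close>, the denominators of \<open>\<Omega>(z)\<close> and \<open>\<Omega>(z\<inverse>)\<close> vanish only at \<open>\<epsilon> = 0\<close>.\<close>
  have eqn: "\<forall>\<^sub>F \<epsilon> in at 0. ?lhs \<epsilon> y = \<Lambda> \<epsilon> * Rn \<epsilon> (xz (z \<epsilon> y))" if "y \<noteq> 1/4" "y \<noteq> - 1/4" for y
    using def eventually_neq_at_within[of "0::real" 0 UNIV]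
  proof eventually_elim
    case (elim \<epsilon>)
    then show ?case
      unfolding \<Omega> \<Lambda> Rn params using that by (intro bi_difference_equation)
  qed
  have lhs: "((\<lambda>\<epsilon>. ?lhs \<epsilon> y / (4 * (1 + q \<epsilon>))) \<longlongrightarrow> ?lim y) (at 0)"
    if "y \<noteq> 1/4" "y \<noteq> - 1/4" for y
  proof -
    have "?lhs \<epsilon> y / (4 * (1 + q \<epsilon>)) =
        \<Omega> \<epsilon> (z \<epsilon> y) / (4 * (1 + q \<epsilon>)) * Rn \<epsilon> (xz (z \<epsilon> y * q \<epsilon>))
        + \<Omega> \<epsilon> (inverse (z \<epsilon> y)) / (4 * (1 + q \<epsilon>)) * Rn \<epsilon> (xz (z \<epsilon> y * inverse (q \<epsilon>)))
        - (\<Omega> \<epsilon> (z \<epsilon> y) / (4 * (1 + q \<epsilon>)) + \<Omega> \<epsilon> (inverse (z \<epsilon> y)) / (4 * (1 + q \<epsilon>))) *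
          Rn \<epsilon> (xz (z \<epsilon> y))" for \<epsilon>
      by (simp only: add_divide_distrib diff_divide_distrib times_divide_eq_left distrib_right)
    then show ?thesis
      by (simp only: of_real_add) (intro tendsto_intros O1 O2 R Rq Rq' that)
  qed
  have rhs: "((\<lambda>\<epsilon>. \<Lambda> \<epsilon> * Rn \<epsilon> (xz (z \<epsilon> y)) / (4 * (1 + q \<epsilon>)))
          \<longlongrightarrow> of_real (bi_lambda r1 r2 \<rho>1 \<rho>2 n) * Rm1 y) (at 0)" for y
    using tendsto_mult[OF L R[of y]] by simp
  have limit_eqn: "?lim y = of_real (bi_lambda r1 r2 \<rho>1 \<rho>2 n) * Rm1 y"
    if "y \<noteq> 1/4" "y \<noteq> - 1/4" for y
  proof (rule tendsto_unique[OF _ lhs[OF that]])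
    show "((\<lambda>\<epsilon>. ?lhs \<epsilon> y / (4 * (1 + q \<epsilon>))) \<longlongrightarrow> of_real (bi_lambda r1 r2 \<rho>1 \<rho>2 n) * Rm1 y) (at 0)"
      using rhs[of y] by (rule Lim_transform_eventually) (use eqn[OF that] in eventually_elim, simp)
  qed simp
  have "Hop r1 r2 \<rho>1 \<rho>2 f y = of_real (bi_Phi1 \<rho>1 \<rho>2 y) * f (- y + 1/2)
        + of_real (bi_Phi2 r1 r2 y) * f (- y - 1/2)
        - of_real (bi_Phi1 \<rho>1 \<rho>2 y + bi_Phi2 r1 r2 y) * f y" for f y
    by (simp add: Hop_def Top_def Rop_def)
  then have eigen: "Hop r1 r2 \<rho>1 \<rho>2 Rm1 y = of_real (bi_lambda r1 r2 \<rho>1 \<rho>2 n) * Rm1 y"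
    if "y \<noteq> 1/4" "y \<noteq> - 1/4" for y
    by (simp only: limit_eqn[OF that])
  have deg: "degree p = n"
    unfolding p_def by (rule degree_bi_limit[OF def0 nondeg])
  have "p \<noteq> 0"
    unfolding p_def by (rule bi_limit_nonzero[OF def0 nondeg])
  have Rm1_fun: "Rm1 = (\<lambda>t. of_real (poly p t))" using Rm1_p by auto
  note monic = monic_bannai_ito_shift[OF \<open>p \<noteq> 0\<close> deg eigen[unfolded Rm1_fun]]
  have poly: "\<exists>p :: real poly. degree p = n \<and> (\<forall>y. Rm1 y = of_real (poly p y)) \<and>
        (\<exists>P. monic_bannai_ito r1 r2 \<rho>1 \<rho>2 n P \<and>
             (\<forall>y. poly p y = lead_coeff p * poly P (y - 1/4)))"
    using deg Rm1_p monic by blast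
  have conj_minus: "Top (- (1/4)) \<circ> Hop r1 r2 \<rho>1 \<rho>2 \<circ> Top (1/4) =
        (\<lambda>f y. of_real (bi_Phi1 \<rho>1 \<rho>2 (y - 1/4)) * Top (- 1) (Rop f) y
             + of_real (bi_Phi2 r1 r2 (y - 1/4)) * Rop f y
             - of_real (bi_Phi1 \<rho>1 \<rho>2 (y - 1/4)) * f y
             - of_real (bi_Phi2 r1 r2 (y - 1/4)) * f y)"
    using Hop_conjugate[of "- (1/4)" r1 r2 \<rho>1 \<rho>2] by (simp add: Top_def)
  show ?thesis
    by (intro conjI allI impI; (elim conjE)?)
      (rule R poly Rq Rq' O1 O2 L eqn lhs rhs limit_eqn eigen Hop_conjugate bi_F_Phi1 bi_G_Phi2
        Lop_conjugate conj_minus | assumption)+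
qed

end
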